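(* Let $C$ be a tropical variety in $\mathbb{R}^d$. If $C$ is not extremal then $W(C)$ is a finitely generated strongly convex cone with a minimal generating set $\Omega=\{\omega_1,\ldots,\omega_n\}$, with each $\omega_i$ being a strictly partial balanced weighting of $C$. Furthermore, given each $C_i$ is the tropical variety formed from the support of $\omega_i$, the set $\{C_1,\ldots,C_n\}$ is exactly the set of extremal tropical varieties of the same dimension as $C$ contained in $C$.
   Context: Tropical varieties. Polyhedral complexes are finite and nonempty; their cells are convex polyhedra, possibly unbounded. Let $C \subset \mathbb{R}^d$ be a polyhedral complex of dimension $k$ (identified with its underlying set). $\widetilde{E}$ is the set of its $k$-dimensional cells (maximal faces) and $\widetilde{V}$ the set of its $(k-1)$-dimensional cells (ridges). $C$ is always assumed pure (every cell of dimension less than $k$ is a face of a $k$-dimensional cell) and rational: for each cell $\rho \in \widetilde{E}\cup\widetilde{V}$, with $L_\rho$ the linear space parallel to $\rho$, the lattice $L_\rho \cap \mathbb{Z}^d$ has rank $\dim \rho$. For $\tau \in \widetilde{V}$, $\sigma \in \widetilde{E}$ with $\tau \subset \sigma$, fix $z_\tau(\sigma) \in L_\sigma \cap \mathbb{Z}^d$ such that $L_\sigma \cap \mathbb{Z}^d = (L_\tau \cap \mathbb{Z}^d) + \mathbb{Z} z_\tau(\sigma)$ and $x + \lambda z_\tau(\sigma) \in \sigma$ for some $x \in \tau$, $\lambda > 0$ (it is unique modulo $L_\tau \cap \mathbb{Z}^d$). A map $\omega$ from $\widetilde{E}$ to $\mathbb{R}_{\geq 0}$ is balanced if for every $\tau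 \in \widetilde{V}$, $\sum_{\sigma \supset \tau} \omega(\sigma) z_\tau(\sigma) \in L_\tau$ (sum over $\sigma \in \widetilde{E}$ having $\tau$ as a face). It is a weighting if its values lie in $\mathbb{Z}_{>0}$, a partial weighting if its values lie in $\mathbb{Z}_{\geq 0}$, and a strictly partial weighting if it is a partial weighting taking the value $0$ somewhere. $C$ is a tropical variety of dimension $k$ if it has a balanced weighting. A tropical variety $C$ is extremal if it cannot be written as $C = C_1 \cup C_2$ with $C_1, C_2$ tropical varieties in $\mathbb{R}^d$ that are both proper subsets of $C$. The tropical variety formed from the support of a nonzero balanced partial weighting $\omega$ is the set $\bigcup\{\sigma \in \widetilde{E} : \omega(\sigma)>0\}$. Cones. A convex cone is a set $K \subseteq \mathbb{R}^m$ with $ax+by \in K$ for all $x,y \in K$, $a,b \geq 0$. It is strongly convex if, for $x,y\in K$, $x+y=0$ holds if and only if $x=y=0$. A generating set of $K$ is a subset $A \subset K$ such that every element of $K$ is a sum of non-negative multiples of finitely many elements of $A$; $K$ is finitely generated if a finite generating set exists. A minimal generating set is a generating set of minimum cardinality. $W(C) \subset \mathbb{R}^{\widetilde{E}}$ is the cone of balanced maps $\omega: \widetilde{E} \to \mathbb{R}_{\geq 0}$. *)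

theory Defs
  imports "HOL-Analysis.Analysis" "HOL-Library.Function_Algebras"
begin

text \<open>
  The pointwise vector space structure on functions. For a set \<open>I\<close>, the space of real families
  indexed by \<open>I\<close> is represented by the functions that vanish outside \<open>I\<close>.
\<close>

instantiation "fun" :: (type, real_vector) real_vector
begin

definition scaleR_fun_def: "scaleR r f = (\<lambda>x. r *\<^sub>R f x)"

instance
  by standard (simp_all add: scaleR_fun_def fun_eq_iff scaleR_add_right scaleR_add_left)

end

text \<open>The library notion \<^const>\<open>convex_cone\<close> includes nonemptiness.\<close>

definition strongly_convex_cone :: "'a::real_vector set \<Rightarrow> bool" where
  "strongly_convex_cone K \<longleftrightarrow>
     convex_cone K \<and> (\<forall>x\<in>K. \<forall>y\<in>K. x + y = 0 \<longleftrightarrow> x = 0 \<and> y = 0)"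

definition generating_set :: "'a::real_vector set \<Rightarrow> 'a set \<Rightarrow> bool" where
  "generating_set K A \<longleftrightarrow>
     A \<subseteq> K \<and>
     (\<forall>x\<in>K. \<exists>F c. finite F \<and> F \<subseteq> A \<and> (\<forall>a\<in>F. 0 \<le> c a) \<and> x = (\<Sum>a\<in>F. c a *\<^sub>R a))"

definition finitely_generated_cone :: "'a::real_vector set \<Rightarrow> bool" where
  "finitely_generated_cone K \<longleftrightarrow> convex_cone K \<and> (\<exists>A. finite A \<and> generating_set K A)"

text \<open>
  Minimum cardinality among generating sets. Only finite competitors are compared, because
  \<^const>\<open>card\<close> is \<open>0\<close> on infinite sets.
\<close>

definition minimal_generating_set :: "'a::real_vector set \<Rightarrow> 'a set \<Rightarrow> bool" where
  "minimal_generating_set K A \<longleftrightarrow>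
     finite A \<and> generating_set K A \<and> (\<forall>B. finite B \<and> generating_set K B \<longrightarrow> card A \<le> card B)"

text \<open>
  Cells are nonempty, so the empty face (of affine dimension \<open>-1\<close>) is never a cell, while two
  cells may still be disjoint since \<open>{}\<close> is a face of every convex set.
\<close>

definition polyhedral_complex :: "(real^'d) set set \<Rightarrow> bool" where
  "polyhedral_complex P \<longleftrightarrow>
     finite P \<and> P \<noteq> {} \<and>
     (\<forall>S\<in>P. polyhedron S \<and> S \<noteq> {}) \<and>
     (\<forall>S\<in>P. \<forall>F. F face_of S \<and> F \<noteq> {} \<longrightarrow> F \<in> P) \<and>
     (\<forall>S\<in>P. \<forall>T\<in>P. (S \<inter> T) face_of S \<and> (S \<inter> T) face_of T)"

definition complex_dim :: "(real^'d) set set \<Rightarrow> int" where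
  "complex_dim P = Max (aff_dim ` P)"

definition max_cells :: "(real^'d) set set \<Rightarrow> (real^'d) set set" where
  "max_cells P = {S \<in> P. aff_dim S = complex_dim P}"

definition ridges :: "(real^'d) set set \<Rightarrow> (real^'d) set set" where
  "ridges P = {S \<in> P. aff_dim S = complex_dim P - 1}"

definition pure_complex :: "(real^'d) set set \<Rightarrow> bool" where
  "pure_complex P \<longleftrightarrow>
     (\<forall>S\<in>P. aff_dim S < complex_dim P \<longrightarrow> (\<exists>T\<in>max_cells P. S face_of T))"

definition parallel_space :: "(real^'d) set \<Rightarrow> (real^'d) set" where
  "parallel_space S = {x - y | x y. x \<in> affine hull S \<and> y \<in> affine hull S}"

definition parallel_lattice :: "(real^'d) set \<Rightarrow> (real^'d) set" where
  "parallel_lattice S = {x \<in> parallel_space S. \<forall>i. x $ i \<in> \<int>}"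

text \<open>The rank of a lattice as a free abelian group: the size of a \<open>\<int>\<close>-basis.\<close>

definition lattice_has_rank :: "(real^'d) set \<Rightarrow> nat \<Rightarrow> bool" where
  "lattice_has_rank L r \<longleftrightarrow>
     (\<exists>B. finite B \<and> card B = r \<and>
        (\<forall>c::real^'d \<Rightarrow> int. (\<Sum>b\<in>B. of_int (c b) *\<^sub>R b) = 0 \<longrightarrow> (\<forall>b\<in>B. c b = 0)) \<and>
        L = {(\<Sum>b\<in>B. of_int (c b) *\<^sub>R b) | c::real^'d \<Rightarrow> int. True})"

definition rational_complex :: "(real^'d) set set \<Rightarrow> bool" where
  "rational_complex P \<longleftrightarrow>
     (\<forall>S \<in> max_cells P \<union> ridges P. lattice_has_rank (parallel_lattice S) (nat (aff_dim S)))"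

text \<open>
  \<open>ridge_normal T S\<close> is a fixed choice of the vector \<open>z\<^sub>T(S)\<close>. In a rational complex it exists
  whenever the ridge \<open>T\<close> is a face of the maximal cell \<open>S\<close>, and it is unique modulo
  \<open>parallel_lattice T\<close>, so balancing does not depend on the choice.
\<close>

definition is_ridge_normal :: "(real^'d) set \<Rightarrow> (real^'d) set \<Rightarrow> real^'d \<Rightarrow> bool" where
  "is_ridge_normal T S z \<longleftrightarrow>
     z \<in> parallel_lattice S \<and>
     parallel_lattice S = {u + of_int m *\<^sub>R z | u m. u \<in> parallel_lattice T} \<and>
     (\<exists>x\<in>T. \<exists>r>0. x + r *\<^sub>R z \<in> S)"

definition ridge_normal :: "(real^'d) set \<Rightarrow> (real^'d) set \<Rightarrow> real^'d" where
  "ridge_normal T S = (SOME z. is_ridge_normal T S z)"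

text \<open>\<open>balanced_maps P\<close> is the cone \<open>W(C)\<close> for the complex \<open>P\<close> with underlying set \<open>C = \<Union>P\<close>.\<close>

definition balanced_maps :: "(real^'d) set set \<Rightarrow> ((real^'d) set \<Rightarrow> real) set" where
  "balanced_maps P =
     {w. (\<forall>S\<in>max_cells P. 0 \<le> w S) \<and> (\<forall>S. S \<notin> max_cells P \<longrightarrow> w S = 0) \<and>
         (\<forall>T\<in>ridges P.
            (\<Sum>S | S \<in> max_cells P \<and> T face_of S. w S *\<^sub>R ridge_normal T S) \<in> parallel_space T)}"

definition weighting :: "(real^'d) set set \<Rightarrow> ((real^'d) set \<Rightarrow> real) \<Rightarrow> bool" where
  "weighting P w \<longleftrightarrow> (\<forall>S\<in>max_cells P. w S \<in> \<int> \<and> 0 < w S)"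

definition partial_weighting :: "(real^'d) set set \<Rightarrow> ((real^'d) set \<Rightarrow> real) \<Rightarrow> bool" where
  "partial_weighting P w \<longleftrightarrow> (\<forall>S\<in>max_cells P. w S \<in> \<int> \<and> 0 \<le> w S)"

definition strictly_partial_weighting ::
    "(real^'d) set set \<Rightarrow> ((real^'d) set \<Rightarrow> real) \<Rightarrow> bool" where
  "strictly_partial_weighting P w \<longleftrightarrow> partial_weighting P w \<and> (\<exists>S\<in>max_cells P. w S = 0)"

definition tropical_complex :: "(real^'d) set set \<Rightarrow> bool" where
  "tropical_complex P \<longleftrightarrow>
     polyhedral_complex P \<and> pure_complex P \<and> rational_complex P \<and>
     (\<exists>w\<in>balanced_maps P. weighting P w)"

text \<open>
  Tropical varieties as subsets of Euclidean space. Unions, inclusions and extremality concern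
  underlying sets; each set may carry its own polyhedral structure.
\<close>

definition tropical_variety :: "int \<Rightarrow> (real^'d) set \<Rightarrow> bool" where
  "tropical_variety k X \<longleftrightarrow> (\<exists>P. tropical_complex P \<and> complex_dim P = k \<and> X = \<Union>P)"

definition extremal_tropical_variety :: "(real^'d) set \<Rightarrow> bool" where
  "extremal_tropical_variety X \<longleftrightarrow>
     (\<exists>k. tropical_variety k X) \<and>
     \<not> (\<exists>X1 X2 k1 k2. tropical_variety k1 X1 \<and> tropical_variety k2 X2 \<and>
          X1 \<subset> X \<and> X2 \<subset> X \<and> X = X1 \<union> X2)"

definition support_variety :: "(real^'d) set set \<Rightarrow> ((real^'d) set \<Rightarrow> real) \<Rightarrow> (real^'d) set" where
  "support_variety P w = \<Union>{S \<in> max_cells P. 0 < w S}"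

end

theory Submission
  imports Defs
begin

text \<open>
  A tropical variety inside \<open>C\<close> of the same dimension induces a balanced integer map on the cells of
  \<open>C\<close> with the same support: its weight is constant along each maximal cell of \<open>C\<close> (connect two
  generic points by a segment that avoids codimension two; at each ridge crossed inside the cell,
  balancing equates the two weights), and balancing at a ridge of \<open>C\<close> can be read off at a generic
  point of that ridge. Conversely, the support of a nonzero integer balanced map is a tropical
  variety. So extremal subvarieties correspond to balanced maps of minimal support. Two balanced maps
  of the same minimal support are proportional, and subtracting multiples of such maps decreases the
  support, so the minimal ones generate \<open>W(C)\<close>. Integer representatives exist because the balancing
  conditions are rational.
\<close>

subsection \<open>Parallel spaces and radial cones\<close>

text \<open>The subvariety comes with its own cells, which need neither refine nor be refined by
  those of \<open>C\<close>, and no common refinement is built. Both structures are compared through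
  the directions that stay in a cell near one generic point: there a maximal cell is locally a whole
  linear space or a half space bounded by the span of a ridge. A parallel lattice depends only on
  the parallel space, so primitive normals of the two structures can be compared modulo the span of
  a ridge, and only two opposite candidates exist. A balancing condition says that a sum lies in a
  subspace; an integer solution is found after introducing coefficients with respect to spanning
  lattice vectors of that subspace as further unknowns. Extremality allows the pieces of a
  decomposition to have any dimensions, so one piece has to be shown to have full dimension.
  Non-extremality of \<open>C\<close> prevents a generator from having full support, since such a
  generator would exhibit \<open>C\<close> itself as extremal.\<close>

lemma parallel_space_eq:
  assumes "a \<in> affine hull S"
  shows "parallel_space S = (\<lambda>x. x - a) ` (affine hull S)"
proof (intro equalityI subsetI)
  fix v assume "v \<in> parallel_space S"
  then obtain x y where v: "v = x - y" and xy: "x \<in> affine hull S" "y \<in> affine hull S"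
    by (auto simp: parallel_space_def)
  have "x + 1 *\<^sub>R (a - y) \<in> affine hull S"
    using mem_affine_3_minus[OF affine_affine_hull xy(1) assms xy(2), of 1] by simp
  then show "v \<in> (\<lambda>x. x - a) ` (affine hull S)"
    unfolding v image_iff by (intro bexI[of _ "x + (a - y)"]) simp_all
qed (use assms in \<open>auto simp: parallel_space_def\<close>)

lemma subspace_parallel_space:
  assumes "S \<noteq> {}"
  shows "subspace (parallel_space S)"
proof -
  obtain a where "a \<in> affine hull S" using assms hull_inc by fastforce
  then show ?thesis
    by (simp add: parallel_space_eq affine_diffs_subspace_subtract)
qed

lemma dim_parallel_space:
  assumes "S \<noteq> {}"
  shows "int (dim (parallel_space S)) = aff_dim S"
proof -
  obtain a where "a \<in> affine hull S" using assms hull_inc by fastforce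
  then show ?thesis
    using aff_dim_eq_dim_subtract[of a "affine hull S"] by (simp add: parallel_space_eq)
qed

lemma parallel_space_mono: "S \<subseteq> T \<Longrightarrow> parallel_space S \<subseteq> parallel_space T"
  unfolding parallel_space_def using hull_mono[of S T affine] by blast

lemma parallel_space_diff: "x \<in> S \<Longrightarrow> y \<in> S \<Longrightarrow> x - y \<in> parallel_space S"
  unfolding parallel_space_def using hull_inc[of x S affine] hull_inc[of y S affine] by blast

lemma parallel_space_eqI:
  assumes "S \<noteq> {}" "T \<noteq> {}" "parallel_space S \<subseteq> parallel_space T" "aff_dim T \<le> aff_dim S"
  shows "parallel_space S = parallel_space T"
proof (rule subspace_dim_equal)
  show "dim (parallel_space T) \<le> dim (parallel_space S)"
    using assms dim_parallel_space[of S] dim_parallel_space[of T] by linarith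
qed (simp_all add: assms subspace_parallel_space)

text \<open>The feasible directions at \<open>x\<close>. For convex \<open>S\<close> containing
  \<open>x\<close>, one admissible step gives all smaller ones, so membership is a statement about
  \<open>S\<close> arbitrarily close to \<open>x\<close>.\<close>

definition radial_cone :: "(real^'d) set \<Rightarrow> real^'d \<Rightarrow> (real^'d) set" where
  "radial_cone S x = {v. \<exists>e>0. x + e *\<^sub>R v \<in> S}"

lemma radial_cone_shrink:
  assumes "convex S" "x \<in> S" "x + e *\<^sub>R v \<in> S" "0 \<le> t" "t \<le> e"
  shows "x + t *\<^sub>R v \<in> S"
proof (cases "e = 0")
  case False
  then have e: "e > 0" using assms by simp
  have "(1 - t / e) *\<^sub>R x + (t / e) *\<^sub>R (x + e *\<^sub>R v) \<in> S"
    using assms e by (intro convexD) auto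
  moreover have "(1 - t / e) *\<^sub>R x + (t / e) *\<^sub>R (x + e *\<^sub>R v) = x + t *\<^sub>R v"
    using e by (simp add: algebra_simps)
  ultimately show ?thesis by simp
qed (use assms in auto)

lemma radial_cone_scale:
  assumes "convex S" "x \<in> S" "v \<in> radial_cone S x" "0 \<le> c"
  shows "c *\<^sub>R v \<in> radial_cone S x"
proof -
  obtain e where e: "e > 0" "x + e *\<^sub>R v \<in> S" using assms by (auto simp: radial_cone_def)
  show ?thesis
  proof (cases "c = 0")
    case True then show ?thesis using assms by (auto simp: radial_cone_def intro!: exI[of _ 1])
  next
    case False
    then show ?thesis using e assms
      by (auto simp: radial_cone_def intro!: exI[of _ "e / c"])
  qed
qed

lemma radial_cone_add:
  assumes "convex S" "x \<in> S" "v \<in> radial_cone S x" "w \<in> radial_cone S x"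
  shows "v + w \<in> radial_cone S x"
proof -
  obtain e f where e: "e > 0" "x + e *\<^sub>R v \<in> S" and f: "f > 0" "x + f *\<^sub>R w \<in> S"
    using assms by (auto simp: radial_cone_def)
  define m where "m = min e f"
  have m: "m > 0" "x + m *\<^sub>R v \<in> S" "x + m *\<^sub>R w \<in> S"
    using e f radial_cone_shrink[OF assms(1,2) e(2)] radial_cone_shrink[OF assms(1,2) f(2)]
    by (auto simp: m_def)
  have "(1/2) *\<^sub>R (x + m *\<^sub>R v) + (1/2) *\<^sub>R (x + m *\<^sub>R w) \<in> S"
    using m assms by (intro convexD) auto
  also have "(1/2) *\<^sub>R (x + m *\<^sub>R v) + (1/2) *\<^sub>R (x + m *\<^sub>R w) = x + (m/2) *\<^sub>R (v + w)"
    by (simp add: vec_eq_iff field_simps)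
  finally show ?thesis using m by (auto simp: radial_cone_def intro!: exI[of _ "m/2"])
qed

lemma radial_cone_mono: "S \<subseteq> T \<Longrightarrow> radial_cone S x \<subseteq> radial_cone T x"
  by (auto simp: radial_cone_def)

lemma radial_cone_Int:
  assumes "convex S" "convex T" "x \<in> S" "x \<in> T"
  shows "radial_cone (S \<inter> T) x = radial_cone S x \<inter> radial_cone T x"
proof (intro equalityI subsetI)
  fix v assume "v \<in> radial_cone S x \<inter> radial_cone T x"
  then obtain e f where e: "e > 0" "x + e *\<^sub>R v \<in> S" and f: "f > 0" "x + f *\<^sub>R v \<in> T"
    by (auto simp: radial_cone_def)
  then have "x + min e f *\<^sub>R v \<in> S \<inter> T"
    using radial_cone_shrink[OF _ _ e(2), of "min e f"] radial_cone_shrink[OF _ _ f(2), of "min e f"] assms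
    by auto
  then show "v \<in> radial_cone (S \<inter> T) x" using e f
    by (auto simp: radial_cone_def intro!: exI[of _ "min e f"])
qed (auto simp: radial_cone_def)

lemma radial_cone_subset_parallel_space:
  assumes "x \<in> S"
  shows "radial_cone S x \<subseteq> parallel_space S"
proof
  fix v assume "v \<in> radial_cone S x"
  then obtain e where e: "e > 0" "x + e *\<^sub>R v \<in> S" by (auto simp: radial_cone_def)
  have "S \<noteq> {}" using assms by auto
  then have "(1/e) *\<^sub>R ((x + e *\<^sub>R v) - x) \<in> parallel_space S"
    using subspace_scale[OF subspace_parallel_space parallel_space_diff[OF e(2) assms]] by blast
  then show "v \<in> parallel_space S" using e by simp
qed

lemma radial_cone_rel_interior:
  assumes "x \<in> rel_interior S"
  shows "radial_cone S x = parallel_space S"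
proof (intro equalityI subsetI)
  have xS: "x \<in> S" using assms rel_interior_subset by blast
  show "v \<in> radial_cone S x \<Longrightarrow> v \<in> parallel_space S" for v
    using radial_cone_subset_parallel_space[OF xS] by blast
  fix v assume v: "v \<in> parallel_space S"
  obtain e where e: "e > 0" "ball x e \<inter> affine hull S \<subseteq> S"
    using assms mem_rel_interior_ball by blast
  have xh: "x \<in> affine hull S" using xS hull_inc by metis
  obtain y where y: "y \<in> affine hull S" "v = y - x"
    using v parallel_space_eq[OF xh] by auto
  define t where "t = e / (2 * (norm v + 1))"
  have nv: "norm v + 1 > 0" by (simp add: add_nonneg_pos)
  have t: "t > 0" using e nv by (simp add: t_def)
  have "t * norm v < e"
  proof -
    have "t * norm v \<le> t * (norm v + 1)" using t by simp
    also have "\<dots> = e / 2" using nv by (simp add: t_def divide_simps)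
    finally show ?thesis using e by simp
  qed
  moreover have "x + t *\<^sub>R v \<in> affine hull S"
    using mem_affine[OF affine_affine_hull xh y(1), of "1 - t" t] by (simp add: y algebra_simps)
  ultimately have "x + t *\<^sub>R v \<in> S" using e t by (auto simp: dist_norm)
  then show "v \<in> radial_cone S x" using t by (auto simp: radial_cone_def)
qed

text \<open>If \<open>v\<close> and \<open>- v\<close> are both feasible and \<open>v\<close> is not
  0, then \<open>x\<close> is the midpoint of a segment in \<open>S\<close>; a face containing such
  a point contains the endpoints.\<close>

lemma radial_cone_face:
  assumes "F face_of S" "convex S" "x \<in> F" "v \<in> radial_cone S x" "- v \<in> radial_cone S x"
  shows "v \<in> radial_cone F x"
proof (cases "v = 0")
  case True then show ?thesis using assms by (auto simp: radial_cone_def intro!: exI[of _ 1])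
next
  case False
  have xS: "x \<in> S" using assms face_of_imp_subset by blast
  obtain e f where e: "e > 0" "x + e *\<^sub>R v \<in> S" and f: "f > 0" "x + f *\<^sub>R (- v) \<in> S"
    using assms by (auto simp: radial_cone_def)
  define m where "m = min e f"
  have m: "m > 0" "x + m *\<^sub>R v \<in> S" "x + m *\<^sub>R (- v) \<in> S"
    using e f radial_cone_shrink[OF assms(2) xS e(2)] radial_cone_shrink[OF assms(2) xS f(2)]
    by (auto simp: m_def)
  have "x \<in> open_segment (x + m *\<^sub>R v) (x + m *\<^sub>R (- v))"
  proof -
    have "x = midpoint (x + m *\<^sub>R v) (x + m *\<^sub>R (- v))"
      by (simp add: midpoint_def vec_eq_iff field_simps)
    moreover have "x + m *\<^sub>R v \<noteq> x + m *\<^sub>R (- v)"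
      using m False by (simp add: scaleR_right.minus eq_neg_iff_add_eq_0 flip: scaleR_2)
    ultimately show ?thesis using midpoint_in_open_segment by metis
  qed
  then have "x + m *\<^sub>R v \<in> F" using face_ofD[OF assms(1)] m assms(3) by blast
  then show ?thesis using m by (auto simp: radial_cone_def)
qed

text \<open>By pigeonhole, infinitely many of the points \<open>x + (e / Suc n) *\<^sub>R v\<close>
  lie in one of the sets. Closedness puts their limit \<open>x\<close> there, and any one of these
  points shows that \<open>v\<close> is feasible.\<close>

lemma radial_cone_Union:
  assumes "finite \<Q>" and "\<And>S. S \<in> \<Q> \<Longrightarrow> closed S"
    and "0 < e" and "\<And>t. 0 < t \<Longrightarrow> t \<le> e \<Longrightarrow> x + t *\<^sub>R v \<in> \<Union>\<Q>"
  obtains S where "S \<in> \<Q>" "x \<in> S" "v \<in> radial_cone S x"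
proof -
  define y where "y n = x + (e / Suc n) *\<^sub>R v" for n
  have "\<exists>S\<in>\<Q>. y n \<in> S" for n
    using assms(3) assms(4)[of "e / Suc n"] by (auto simp: y_def divide_simps)
  then obtain c where c: "\<And>n. c n \<in> \<Q>" "\<And>n. y n \<in> c n" by metis
  have "\<exists>S\<in>\<Q>. \<exists>\<^sub>\<infinity>n. c n = S"
  proof (rule ccontr)
    assume "\<not> ?thesis"
    then have "\<forall>S\<in>\<Q>. finite {n. c n = S}" by (auto simp: frequently_cofinite)
    then have "finite (\<Union>S\<in>\<Q>. {n. c n = S})" using assms(1) by blast
    moreover have "(\<Union>S\<in>\<Q>. {n. c n = S}) = UNIV" using c by auto
    ultimately show False by simp
  qed
  then obtain S where S: "S \<in> \<Q>" "infinite {n. c n = S}" by (auto simp: frequently_cofinite)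
  then obtain r :: "nat \<Rightarrow> nat" where r: "strict_mono r" "\<And>n. r n \<in> {n. c n = S}"
    using infinite_enumerate by blast
  have yS: "y (r n) \<in> S" for n using c(2)[of "r n"] r(2)[of n] by simp
  have "(\<lambda>n. e / Suc n) \<longlonglongrightarrow> 0" by (rule LIMSEQ_Suc[OF lim_const_over_n])
  then have "y \<longlonglongrightarrow> x + 0 *\<^sub>R v" unfolding y_def by (intro tendsto_intros)
  then have "(y \<circ> r) \<longlonglongrightarrow> x" using LIMSEQ_subseq_LIMSEQ[OF _ r(1)] by simp
  then have "x \<in> S" using closed_sequentially[OF assms(2)[OF S(1)], of "y \<circ> r" x] yS by auto
  moreover have "v \<in> radial_cone S x"
    using yS[of 0] assms(3) unfolding radial_cone_def y_def
    by (auto intro!: exI[of _ "e / Suc (r 0)"])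
  ultimately show thesis using S that by blast
qed

section \<open>Generic points: finite covers of convex sets\<close>

lemma convex_subset_Union_affine:
  fixes S :: "'a::real_vector set"
  assumes "finite \<A>" "\<And>A. A \<in> \<A> \<Longrightarrow> affine A" "convex S" "S \<noteq> {}" "S \<subseteq> \<Union>\<A>"
  shows "\<exists>A\<in>\<A>. S \<subseteq> A"
  using assms(1,2,5)
proof (induction \<A> rule: finite_induct)
  case empty
  then show ?case using assms by auto
next
  case (insert A \<A>)
  show ?case
  proof (cases "S \<subseteq> A")
    case False
    \<comment> \<open>Since \<open>p\<close> is not in \<open>A\<close>, the segment from
      \<open>p\<close> to any \<open>y\<close> in \<open>S\<close> meets \<open>A\<close> for at
      most one parameter. Infinitely many parameters fall into the remaining spaces, two of them
      into the same one, and that space then contains the whole line and \<open>y\<close>.\<close>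
    then obtain p where p: "p \<in> S" "p \<notin> A" by auto
    have "S \<subseteq> \<Union>\<A>"
    proof
      fix y assume y: "y \<in> S"
      define g where "g t = p + t *\<^sub>R (y - p)" for t :: real
      have comb: "g c \<in> B" if "affine B" "g a \<in> B" "g b \<in> B" "a \<noteq> b" for B a b c
      proof -
        define u where "u = (c - a) / (b - a)"
        have "(1 - u) *\<^sub>R g a + u *\<^sub>R g b \<in> B" using that by (intro mem_affine) auto
        also have "(1 - u) *\<^sub>R g a + u *\<^sub>R g b = p + ((1 - u) * a + u * b) *\<^sub>R (y - p)"
          by (simp add: g_def algebra_simps)
        also have "(1 - u) * a + u * b = a + u * (b - a)" by (simp add: algebra_simps)
        also have "\<dots> = c" using that by (simp add: u_def)
        finally show ?thesis by (simp add: g_def)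
      qed
      have gS: "g t \<in> S" if "0 \<le> t" "t \<le> 1" for t
        using convexD[OF \<open>convex S\<close> p(1) y, of "1 - t" t] that by (simp add: g_def algebra_simps)
      have "g 0 = p" by (simp add: g_def)
      have A1: "a = b" if "g a \<in> A" "g b \<in> A" for a b
      proof (rule ccontr)
        assume "a \<noteq> b"
        moreover have "affine A" using insert.prems by blast
        ultimately show False using comb[OF _ that, of 0] p \<open>g 0 = p\<close> by simp
      qed
      then have "\<exists>a. {t. g t \<in> A} \<subseteq> {a}" by (cases "\<exists>a. g a \<in> A") auto
      then have "finite {t. g t \<in> A}" using finite_subset by fastforce
      moreover have "infinite {0..1::real}" by simp
      ultimately have inf: "infinite ({0..1} - {t. g t \<in> A})" by simp
      have "({0..1} - {t. g t \<in> A}) \<subseteq> (\<Union>B\<in>\<A>. {t. g t \<in> B})"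
      proof
        fix t assume t: "t \<in> {0..1} - {t. g t \<in> A}"
        then have "g t \<in> S" using gS by simp
        then have "g t \<in> \<Union>(insert A \<A>)" using insert.prems(2) by blast
        then show "t \<in> (\<Union>B\<in>\<A>. {t. g t \<in> B})" using t by blast
      qed
      then have "infinite (\<Union>B\<in>\<A>. {t. g t \<in> B})" using inf finite_subset by blast
      then have "\<exists>B\<in>\<A>. infinite {t. g t \<in> B}" using insert.hyps(1) by simp
      then obtain B where B: "B \<in> \<A>" "infinite {t. g t \<in> B}" by blast
      then obtain a where a: "g a \<in> B" using infinite_imp_nonempty by blast
      obtain b where b: "g b \<in> B" "b \<noteq> a"
        using infinite_imp_nonempty[OF infinite_remove[OF B(2), of a]] by blast
      have "affine B" using insert.prems B by blast
      then have "g 1 \<in> B" using comb[of B a b 1] a b by blast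
      then show "y \<in> \<Union>\<A>" using B by (auto simp: g_def)
    qed
    then show ?thesis using insert by blast
  qed auto
qed

text \<open>Passing to affine hulls keeps the dimensions, so no single hull contains
  \<open>S\<close>, and hence finitely many do not cover it. This is the source of all generic
  points below.\<close>

lemma convex_avoid_low_dim:
  fixes S :: "'a::euclidean_space set"
  assumes "finite \<A>" "convex S" "S \<noteq> {}" "\<And>A. A \<in> \<A> \<Longrightarrow> aff_dim A < aff_dim S"
  obtains x where "x \<in> S" "\<And>A. A \<in> \<A> \<Longrightarrow> x \<notin> A"
proof -
  have "\<not> S \<subseteq> \<Union>((\<lambda>A. affine hull A) ` \<A>)"
  proof
    assume "S \<subseteq> \<Union>((\<lambda>A. affine hull A) ` \<A>)"
    then have "\<exists>B\<in>(\<lambda>A. affine hull A) ` \<A>. S \<subseteq> B"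
      using assms(1) by (intro convex_subset_Union_affine[OF _ _ assms(2,3)]) auto
    then obtain A where "A \<in> \<A>" "S \<subseteq> affine hull A" by auto
    then show False using aff_dim_subset[of S "affine hull A"] assms(4)[of A] by simp
  qed
  then obtain x where x: "x \<in> S" "\<And>A. A \<in> \<A> \<Longrightarrow> x \<notin> affine hull A" by auto
  have "x \<notin> A" if "A \<in> \<A>" for A using x(2)[OF that] hull_inc[of x A affine] by argo
  then show thesis using that x(1) by simp
qed

text \<open>If every trace \<open>q \<inter> S\<close> had smaller dimension, some point of
  \<open>S\<close> would avoid all of them.\<close>

lemma convex_cover_full_dim:
  fixes S :: "'a::euclidean_space set"
  assumes "finite \<Q>" "convex S" "S \<noteq> {}" "S \<subseteq> \<Union>\<Q>"
  shows "\<exists>q\<in>\<Q>. aff_dim (q \<inter> S) = aff_dim S"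
proof (rule ccontr)
  assume no: "\<not> ?thesis"
  have lt: "aff_dim A < aff_dim S" if A: "A \<in> (\<lambda>q. q \<inter> S) ` \<Q>" for A
  proof -
    obtain q where q: "q \<in> \<Q>" "A = q \<inter> S" using A by blast
    then have "aff_dim A \<le> aff_dim S" "aff_dim A \<noteq> aff_dim S"
      using no aff_dim_subset[of A S] by auto
    then show ?thesis by simp
  qed
  obtain x where x: "x \<in> S" "\<And>A. A \<in> (\<lambda>q. q \<inter> S) ` \<Q> \<Longrightarrow> x \<notin> A"
    using convex_avoid_low_dim[OF finite_imageI[OF assms(1)] assms(2,3) lt] by metis
  then show False using assms(4) by blast
qed

subsection \<open>Parallel lattices and primitive normals\<close>

text \<open>By Dirichlet's theorem some multiple of the real solution is so close to an integer vector
  that the integer values of the equations at that vector are smaller than 1.\<close>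

lemma integer_solution_same_signs:
  fixes a :: "'j \<Rightarrow> 'i \<Rightarrow> real" and w :: "'i \<Rightarrow> real"
  assumes "finite I" "finite J"
    and int: "\<And>j i. j \<in> J \<Longrightarrow> i \<in> I \<Longrightarrow> a j i \<in> \<int>"
    and sol: "\<And>j. j \<in> J \<Longrightarrow> (\<Sum>i\<in>I. a j i * w i) = 0"
  obtains p :: "'i \<Rightarrow> int" where
    "\<And>j. j \<in> J \<Longrightarrow> (\<Sum>i\<in>I. a j i * of_int (p i)) = 0"
    "\<And>i. i \<in> I \<Longrightarrow> sgn (real_of_int (p i)) = sgn (w i)"
proof -
  define M where "M = (\<Sum>j\<in>J. \<Sum>i\<in>I. \<bar>a j i\<bar>)"
  have M: "(\<Sum>i\<in>I. \<bar>a j i\<bar>) \<le> M" if "j \<in> J" for j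
    unfolding M_def by (rule member_le_sum[OF that]) (auto simp: assms sum_nonneg)
  have M0: "M \<ge> 0" unfolding M_def by (intro sum_nonneg) auto
  define D where "D = Min (insert 1 ((\<lambda>i. \<bar>w i\<bar>) ` {i\<in>I. w i \<noteq> 0}))"
  have D0: "D > 0" unfolding D_def using assms(1) by (subst Min_gr_iff) auto
  have D: "D \<le> \<bar>w i\<bar>" if "i \<in> I" "w i \<noteq> 0" for i
    unfolding D_def using assms(1) that by (intro Min_le) auto
  \<comment> \<open>Rounding errors will be below \<open>1 / N\<close>: \<open>N > M\<close> keeps
    each integer equation below 1 in absolute value, \<open>N > 1 / D\<close> preserves the signs of
    nonzero entries, and \<open>N > 1\<close> makes zero entries round to 0.\<close>
  obtain N :: nat where N: "real N > M + 1 + 1 / D" using reals_Archimedean2 by blast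
  have "1 / D > 0" using D0 by simp
  then have N1: "real N > M" "real N > 1 / D" "real N > 1" using N M0 by linarith+
  then have N0: "N > 0" by simp
  have ND: "1 / real N < D" using N1(2) D0 N0 by (simp add: divide_simps mult.commute)
  obtain h where h: "bij_betw h {0..<card I} I" using ex_bij_betw_nat_finite assms(1) by blast
  define g where "g = the_inv_into {0..<card I} h"
  obtain q p where q: "0 < q"
    and p: "\<And>k. k < card I \<Longrightarrow> \<bar>of_int q * w (h k) - of_int (p k)\<bar> < 1 / real N"
    using Dirichlet_approx_simult[OF N0, of "card I" "\<lambda>k. w (h k)"] by metis
  have g: "g i < card I" "h (g i) = i" if "i \<in> I" for i
    using that h the_inv_into_into[of h "{0..<card I}" i "{0..<card I}"] f_the_inv_into_f_bij_betw[OF h, of i]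
    unfolding g_def bij_betw_def by auto
  define P where "P i = p (g i)" for i
  have P: "\<bar>of_int q * w i - of_int (P i)\<bar> < 1 / real N" if "i \<in> I" for i
    using p[OF g(1)[OF that]] g(2)[OF that] by (simp add: P_def)
  show thesis
  proof
    fix j assume j: "j \<in> J"
    define s where "s = (\<Sum>i\<in>I. a j i * of_int (P i))"
    have "s \<in> \<int>" unfolding s_def using int[OF j] by (intro Ints_sum Ints_mult) auto
    have "s = (\<Sum>i\<in>I. a j i * (of_int (P i) - of_int q * w i)) + of_int q * (\<Sum>i\<in>I. a j i * w i)"
      unfolding s_def by (simp add: sum_distrib_left algebra_simps flip: sum.distrib)
    then have "\<bar>s\<bar> = \<bar>\<Sum>i\<in>I. a j i * (of_int (P i) - of_int q * w i)\<bar>" using sol[OF j] by simp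
    also have "\<dots> \<le> (\<Sum>i\<in>I. \<bar>a j i * (of_int (P i) - of_int q * w i)\<bar>)" by (rule sum_abs)
    also have "\<dots> \<le> (\<Sum>i\<in>I. \<bar>a j i\<bar> * (1 / real N))"
    proof (rule sum_mono)
      fix i assume "i \<in> I"
      then have "\<bar>of_int (P i) - of_int q * w i\<bar> \<le> 1 / real N"
        using P[of i] by (simp only: abs_minus_commute less_imp_le)
      then show "\<bar>a j i * (of_int (P i) - of_int q * w i)\<bar> \<le> \<bar>a j i\<bar> * (1 / real N)"
        unfolding abs_mult by (rule mult_left_mono) simp
    qed
    also have "\<dots> = (\<Sum>i\<in>I. \<bar>a j i\<bar>) / real N" by (simp add: sum_divide_distrib)
    also have "\<dots> \<le> M / real N" using M[OF j] N0 by (simp add: divide_right_mono)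
    also have "\<dots> < 1" using N1 N0 by simp
    finally have "\<bar>s\<bar> < 1" .
    then show "(\<Sum>i\<in>I. a j i * of_int (P i)) = 0"
      using \<open>s \<in> \<int>\<close> Ints_nonzero_abs_less1 unfolding s_def by blast
  next
    fix i assume i: "i \<in> I"
    have q1: "real_of_int q \<ge> 1" using q by simp
    have N1': "1 / real N < 1" using N1(3) by simp
    consider "w i = 0" | "w i > 0" | "w i < 0" by linarith
    then show "sgn (real_of_int (P i)) = sgn (w i)"
    proof cases
      case 1
      then have "\<bar>real_of_int (P i)\<bar> < 1" using P[OF i] N1' by simp
      then have "P i = 0" by linarith
      then show ?thesis using 1 by simp
    next
      case 2
      then have "w i \<le> q * w i" using q1 by simp
      then have "real_of_int (P i) > 0" using P[OF i] ND D[OF i] 2 by linarith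
      then show ?thesis using 2 by simp
    next
      case 3
      then have "q * w i \<le> w i" using q1 by simp
      then have "real_of_int (P i) < 0" using P[OF i] ND D[OF i] 3 by linarith
      then show ?thesis using 3 by simp
    qed
  qed
qed

text \<open>A real dependence solves homogeneous equations with integer coefficients, so it yields
  an integer dependence with the same signs, which is again nontrivial.\<close>

lemma independent_integer_vectors:
  fixes B :: "(real^'d) set"
  assumes "finite B" and int: "\<And>b i. b \<in> B \<Longrightarrow> b $ i \<in> \<int>"
    and indep: "\<And>c::real^'d \<Rightarrow> int. (\<Sum>b\<in>B. of_int (c b) *\<^sub>R b) = 0 \<Longrightarrow> \<forall>b\<in>B. c b = 0"
  shows "independent B"
proof
  assume "dependent B"
  then obtain u v where v: "v \<in> B" "u v \<noteq> 0" and u: "(\<Sum>b\<in>B. u b *\<^sub>R b) = 0"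
    using dependent_finite[OF assms(1)] by auto
  have "(\<Sum>b\<in>B. b $ j * u b) = 0" for j
    using arg_cong[OF u, of "\<lambda>x. x $ j"] by (simp add: mult.commute)
  then obtain p :: "real^'d \<Rightarrow> int" where
    p: "\<And>j. (\<Sum>b\<in>B. b $ j * of_int (p b)) = 0" "\<And>b. b \<in> B \<Longrightarrow> sgn (real_of_int (p b)) = sgn (u b)"
    using integer_solution_same_signs[of B "UNIV :: 'd set" "\<lambda>j b. b $ j" u] assms(1) int
    by (metis UNIV_I finite)
  have "(\<Sum>b\<in>B. of_int (p b) *\<^sub>R b) = 0" using p(1) by (simp add: vec_eq_iff mult.commute)
  then have "p v = 0" using indep v by blast
  then show False using p(2)[OF v(1)] v(2) by (simp add: sgn_if split: if_splits)
qed

lemma parallel_lattice_subset: "parallel_lattice S \<subseteq> parallel_space S"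
  by (auto simp: parallel_lattice_def)

text \<open>The rank only provides a basis over the integers. Its vectors are independent over the
  reals as well, and their number is the dimension.\<close>

lemma parallel_lattice_spans:
  fixes S :: "(real^'d) set"
  assumes "S \<noteq> {}" "lattice_has_rank (parallel_lattice S) (nat (aff_dim S))"
  obtains B where "finite B" "B \<subseteq> parallel_lattice S" "span B = parallel_space S"
proof -
  obtain B where B: "finite B" "card B = nat (aff_dim S)"
    "\<And>c::real^'d \<Rightarrow> int. (\<Sum>b\<in>B. of_int (c b) *\<^sub>R b) = 0 \<Longrightarrow> \<forall>b\<in>B. c b = 0"
    "parallel_lattice S = {(\<Sum>b\<in>B. of_int (c b) *\<^sub>R b) | c::real^'d \<Rightarrow> int. True}"
    using assms(2) unfolding lattice_has_rank_def by blast
  have sub: "B \<subseteq> parallel_lattice S"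
  proof
    fix b assume b: "b \<in> B"
    have "b = (\<Sum>b'\<in>B. of_int (if b' = b then 1 else 0) *\<^sub>R b')"
      using b B(1) by (simp add: if_distrib[of of_int] if_distrib[of "\<lambda>x. x *\<^sub>R _"] cong: if_cong)
    then show "b \<in> parallel_lattice S" unfolding B(4)
      by (intro CollectI exI[of _ "\<lambda>b'. if b' = b then 1 else 0"]) simp
  qed
  then have ind: "independent B"
    using B(1,3) by (intro independent_integer_vectors) (auto simp: parallel_lattice_def)
  have ssp: "span B \<subseteq> parallel_space S"
    using sub parallel_lattice_subset subspace_parallel_space[OF assms(1)] span_minimal by blast
  have "span B = parallel_space S"
  proof (rule subspace_dim_equal)
    show "dim (parallel_space S) \<le> dim (span B)"
      using dim_parallel_space[OF assms(1)] B(2) dim_span_eq_card_independent[OF ind]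
      by simp
  qed (simp_all add: ssp assms subspace_parallel_space)
  then show thesis using that B(1) sub by blast
qed

lemma parallel_lattice_add:
  assumes "S \<noteq> {}" "u \<in> parallel_lattice S" "v \<in> parallel_lattice S"
  shows "u + v \<in> parallel_lattice S"
  using assms subspace_add[OF subspace_parallel_space[OF assms(1)]] by (auto simp: parallel_lattice_def)

lemma parallel_lattice_scale:
  assumes "S \<noteq> {}" "u \<in> parallel_lattice S"
  shows "of_int m *\<^sub>R u \<in> parallel_lattice S"
  using assms subspace_scale[OF subspace_parallel_space[OF assms(1)]] by (auto simp: parallel_lattice_def)

lemma parallel_lattice_sum:
  assumes "S \<noteq> {}" "\<And>b. b \<in> B \<Longrightarrow> f b \<in> parallel_lattice S"
  shows "sum f B \<in> parallel_lattice S"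
  using assms subspace_sum[OF subspace_parallel_space[OF assms(1)], of B f]
  by (auto simp: parallel_lattice_def intro!: Ints_sum)

lemma parallel_lattice_mono: "S \<subseteq> T \<Longrightarrow> parallel_lattice S \<subseteq> parallel_lattice T"
  using parallel_space_mono by (auto simp: parallel_lattice_def)

lemma finite_bounded_integer_vectors: "finite {v::real^'d. (\<forall>i. v $ i \<in> \<int>) \<and> norm v \<le> R}"
proof -
  have "{v::real^'d. (\<forall>i. v $ i \<in> \<int>) \<and> norm v \<le> R} \<subseteq>
    (\<lambda>g. \<chi> i. real_of_int (g i)) ` (PiE UNIV (\<lambda>_. {- \<lceil>R\<rceil>..\<lceil>R\<rceil>}))"
  proof
    fix v :: "real^'d" assume "v \<in> {v::real^'d. (\<forall>i. v $ i \<in> \<int>) \<and> norm v \<le> R}"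
    then have v: "\<And>i. v $ i \<in> \<int>" "norm v \<le> R" by auto
    have "\<bar>v $ i\<bar> \<le> of_int \<lceil>R\<rceil>" for i
      using component_le_norm_cart[of v i] v(2) le_of_int_ceiling[of R] by linarith
    then have "\<lfloor>v $ i\<rfloor> \<in> {- \<lceil>R\<rceil>..\<lceil>R\<rceil>}" for i
      using v(1)[of i] by (auto elim!: Ints_cases) (metis abs_le_iff minus_le_iff of_int_le_iff of_int_minus)+
    moreover have "v = (\<chi> i. real_of_int \<lfloor>v $ i\<rfloor>)" using v(1) by (simp add: vec_eq_iff)
    ultimately show "v \<in> (\<lambda>g. \<chi> i. real_of_int (g i)) ` (PiE UNIV (\<lambda>_. {- \<lceil>R\<rceil>..\<lceil>R\<rceil>}))"
      by (auto simp: PiE_UNIV_domain intro!: image_eqI[where x = "\<lambda>i. \<lfloor>v $ i\<rfloor>"])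
  qed
  then show ?thesis by (rule finite_subset) (intro finite_imageI finite_PiE; simp)
qed

text \<open>The definition tests the direction at some point \<open>y\<close> of the ridge. At a
  relative interior point \<open>x\<close> both \<open>y - x\<close> and its negative are feasible,
  so the test can be moved to \<open>x\<close>.\<close>

lemma is_ridge_normal_radial_cone:
  assumes "is_ridge_normal T S z" "T \<subseteq> S" "convex S" "x \<in> rel_interior T"
  shows "z \<in> radial_cone S x"
proof -
  obtain y r where y: "y \<in> T" "r > 0" "y + r *\<^sub>R z \<in> S"
    using assms(1) by (auto simp: is_ridge_normal_def)
  have xT: "x \<in> T" using assms(4) rel_interior_subset by blast
  have xS: "x \<in> S" using xT assms(2) by blast
  have "y - x \<in> parallel_space T" using parallel_space_diff[OF y(1) xT] .
  moreover have "- (y - x) \<in> parallel_space T" using parallel_space_diff[OF xT y(1)] by simp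
  ultimately have "- (y - x) \<in> radial_cone S x"
    using radial_cone_rel_interior[OF assms(4)] radial_cone_mono[OF assms(2)] by blast
  moreover have "(y - x) + r *\<^sub>R z \<in> radial_cone S x"
    using y(3) by (auto simp: radial_cone_def intro!: exI[of _ 1])
  ultimately have "r *\<^sub>R z \<in> radial_cone S x"
    using radial_cone_add[OF assms(3) xS] by fastforce
  then have "(1/r) *\<^sub>R (r *\<^sub>R z) \<in> radial_cone S x"
    using radial_cone_scale[OF assms(3) xS, of "r *\<^sub>R z" "1/r"] y(2) by simp
  then show ?thesis using y(2) by simp
qed

text \<open>A primitive normal is a lattice vector of minimal positive height above the ridge: reducing
  modulo the ridge lattice, only finitely many lattice vectors compete.\<close>

lemma is_ridge_normal_exists:
  fixes S T :: "(real^'d) set"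
  assumes "T \<noteq> {}" "T \<subseteq> S" "convex S" "convex T" and dim: "aff_dim S = aff_dim T + 1"
    and rS: "lattice_has_rank (parallel_lattice S) (nat (aff_dim S))"
    and rT: "lattice_has_rank (parallel_lattice T) (nat (aff_dim T))"
  shows "\<exists>z. is_ridge_normal T S z"
proof -
  have S0: "S \<noteq> {}" using assms by auto
  note subS = subspace_parallel_space[OF S0] and subT = subspace_parallel_space[OF assms(1)]
  note LTS = parallel_space_mono[OF assms(2)]
  obtain x where x: "x \<in> rel_interior T" using assms(1,4) rel_interior_eq_empty by blast
  have xT: "x \<in> T" using x rel_interior_subset by blast
  have xS: "x \<in> S" using xT assms(2) by blast
  have "\<not> S \<subseteq> affine hull T"
  proof
    assume "S \<subseteq> affine hull T"
    then have "aff_dim S \<le> aff_dim T" using aff_dim_subset[of S "affine hull T"] by simp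
    then show False using dim by simp
  qed
  then obtain s where s: "s \<in> S" "s \<notin> affine hull T" by blast
  have sx: "s - x \<notin> parallel_space T"
  proof
    assume "s - x \<in> parallel_space T"
    then have "s - x \<in> (\<lambda>y. y - x) ` (affine hull T)"
      using parallel_space_eq[of x T] hull_inc[OF xT, of affine] by simp
    then show False using s(2) by auto
  qed
  \<comment> \<open>\<open>n\<close> is the part of \<open>s - x\<close> orthogonal to the ridge, so
    the inner product with \<open>n\<close> measures the height above the ridge.\<close>
  obtain y n where yn: "y \<in> span (parallel_space T)" "\<And>w. w \<in> span (parallel_space T) \<Longrightarrow> orthogonal n w" "s - x = y + n"
    using orthogonal_subspace_decomp_exists[of "parallel_space T" "s - x"] by metis
  have spT: "span (parallel_space T) = parallel_space T" using subT by (simp add: span_eq_iff)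
  have yT: "y \<in> parallel_space T" using yn(1) spT by simp
  have nT: "n \<bullet> w = 0" if "w \<in> parallel_space T" for w
    using yn(2) that spT by (simp add: orthogonal_def)
  have n0: "n \<noteq> 0" using yn(3) yT sx by auto
  then have nn: "n \<bullet> n > 0" by simp
  have nS: "n \<in> parallel_space S"
  proof -
    have "(s - x) - y \<in> parallel_space S"
      using subspace_diff[OF subS] parallel_space_diff[OF s(1) xS] yT LTS by blast
    then show ?thesis using yn(3) by simp
  qed
  \<comment> \<open>The height vanishes only on the parallel space of \<open>T\<close>, because
    \<open>T\<close> has codimension one in \<open>S\<close>.\<close>
  have ker: "v \<in> parallel_space T" if "v \<in> parallel_space S" "n \<bullet> v = 0" for v
  proof -
    define K where "K = {v \<in> parallel_space S. n \<bullet> v = 0}"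
    have sK: "subspace K"
      unfolding K_def using subS by (auto simp: subspace_def inner_right_distrib)
    have "parallel_space T \<subseteq> K" using LTS nT by (auto simp: K_def)
    moreover have "dim K \<le> dim (parallel_space T)"
    proof -
      have "n \<notin> K" using nn by (simp add: K_def)
      then have "K \<subset> parallel_space S" using nS K_def by blast
      then have "dim K < dim (parallel_space S)"
        using sK subS by (metis dim_psubset span_eq_iff)
      then show ?thesis using dim_parallel_space[OF S0] dim_parallel_space[OF assms(1)] dim by linarith
    qed
    ultimately have "parallel_space T = K" using subspace_dim_equal[OF subT sK] by blast
    then show ?thesis using that by (auto simp: K_def)
  qed
  obtain BS where BS: "finite BS" "BS \<subseteq> parallel_lattice S" "span BS = parallel_space S"
    using parallel_lattice_spans[OF S0 rS] by blast
  obtain BT where BT: "finite BT" "BT \<subseteq> parallel_lattice T" "span BT = parallel_space T"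
    using parallel_lattice_spans[OF assms(1) rT] by blast
  have "\<exists>v\<in>parallel_lattice S. n \<bullet> v > 0"
  proof -
    have "\<exists>b\<in>BS. n \<bullet> b \<noteq> 0"
    proof (rule ccontr)
      assume "\<not> ?thesis"
      then have "BS \<subseteq> {v. n \<bullet> v = 0}" by auto
      moreover have "subspace {v. n \<bullet> v = 0}" by (simp add: subspace_hyperplane)
      ultimately have "span BS \<subseteq> {v. n \<bullet> v = 0}" by (rule span_minimal)
      then show False using BS(3) nS nn by auto
    qed
    then obtain b where b: "b \<in> BS" "n \<bullet> b \<noteq> 0" by blast
    show ?thesis
    proof (cases "n \<bullet> b > 0")
      case False
      then have "n \<bullet> (of_int (-1) *\<^sub>R b) > 0" using b by simp
      then show ?thesis using parallel_lattice_scale[OF S0, of b "-1"] b BS by blast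
    qed (use b BS in blast)
  qed
  then obtain v0 where v0: "v0 \<in> parallel_lattice S" "n \<bullet> v0 > 0" by blast
  \<comment> \<open>Bound for a reduced vector: fractional coordinates along \<open>BT\<close>
    contribute at most the sum of the norms, and the part along \<open>n\<close> has length height
    divided by \<open>norm n\<close>, with height at most that of \<open>v0\<close>.\<close>
  define R where "R = (\<Sum>b\<in>BT. norm b) + (n \<bullet> v0) / norm n"
  define A where "A = {v \<in> parallel_lattice S. 0 < n \<bullet> v \<and> n \<bullet> v \<le> n \<bullet> v0 \<and> norm v \<le> R}"
  have "finite A"
    using finite_bounded_integer_vectors[of R]
    by (rule rev_finite_subset) (auto simp: A_def parallel_lattice_def)
  have reduce: "\<exists>u\<in>A. n \<bullet> u = n \<bullet> v" if v: "v \<in> parallel_lattice S" "0 < n \<bullet> v" "n \<bullet> v \<le> n \<bullet> v0" for v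
  proof -
    define c where "c = (n \<bullet> v) / (n \<bullet> n)"
    have "v - c *\<^sub>R n \<in> parallel_space S"
      using v nS subS parallel_lattice_subset by (blast intro: subspace_diff subspace_scale)
    moreover have "n \<bullet> (v - c *\<^sub>R n) = 0" using nn by (simp add: inner_diff_right c_def)
    ultimately have "v - c *\<^sub>R n \<in> span BT" using ker BT by blast
    then obtain r where r: "v - c *\<^sub>R n = (\<Sum>b\<in>BT. r b *\<^sub>R b)"
      using span_finite[OF BT(1)] by auto
    define f where "f = (\<Sum>b\<in>BT. of_int \<lfloor>r b\<rfloor> *\<^sub>R b)"
    have fT: "f \<in> parallel_lattice T" unfolding f_def
      using BT by (intro parallel_lattice_sum parallel_lattice_scale assms) auto
    define u where "u = v - f"
    have uS: "u \<in> parallel_lattice S"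
    proof -
      have "of_int (-1) *\<^sub>R f \<in> parallel_lattice S"
        using fT parallel_lattice_mono[OF assms(2)] by (intro parallel_lattice_scale[OF S0]) auto
      then show ?thesis using parallel_lattice_add[OF S0 v(1)] unfolding u_def by fastforce
    qed
    have "n \<bullet> f = 0" using fT nT parallel_lattice_subset by blast
    then have nu: "n \<bullet> u = n \<bullet> v" by (simp add: u_def inner_diff_right)
    have "u = (\<Sum>b\<in>BT. frac (r b) *\<^sub>R b) + c *\<^sub>R n"
      using r by (simp add: u_def f_def frac_def algebra_simps sum_subtractf sum.distrib)
    then have "norm u \<le> norm (\<Sum>b\<in>BT. frac (r b) *\<^sub>R b) + norm (c *\<^sub>R n)"
      using norm_triangle_ineq by metis
    also have "norm (\<Sum>b\<in>BT. frac (r b) *\<^sub>R b) \<le> (\<Sum>b\<in>BT. norm b)"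
    proof (rule order.trans[OF norm_sum sum_mono])
      fix b assume "b \<in> BT"
      show "norm (frac (r b) *\<^sub>R b) \<le> norm b"
        using frac_lt_1[of "r b"] frac_ge_0[of "r b"] by (simp add: mult_left_le_one_le)
    qed
    also have "norm (c *\<^sub>R n) = (n \<bullet> v) / norm n"
      using v(2) n0 by (simp add: c_def power2_norm_eq_inner[symmetric] power2_eq_square)
    also have "\<dots> \<le> (n \<bullet> v0) / norm n" using v(3) by (simp add: divide_right_mono)
    finally have "norm u \<le> R" by (simp add: R_def)
    then show ?thesis using uS nu v by (auto simp: A_def)
  qed
  have "A \<noteq> {}" using reduce[OF v0] by auto
  define z where "z = arg_min_on (\<lambda>v. n \<bullet> v) A"
  have zA: "z \<in> A" and zmin: "\<And>v. v \<in> A \<Longrightarrow> n \<bullet> z \<le> n \<bullet> v"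
    unfolding z_def using arg_min_if_finite[OF \<open>finite A\<close> \<open>A \<noteq> {}\<close>, of "\<lambda>v. n \<bullet> v"] by (auto simp: not_less)
  have zS: "z \<in> parallel_lattice S" and z0: "n \<bullet> z > 0" and zv0: "n \<bullet> z \<le> n \<bullet> v0"
    using zA by (auto simp: A_def)
  have "parallel_lattice S = {u + of_int m *\<^sub>R z | u m. u \<in> parallel_lattice T}"
  proof (intro equalityI subsetI)
    fix v assume v: "v \<in> parallel_lattice S"
    \<comment> \<open>Division with remainder by the height of \<open>z\<close>: the remainder
      \<open>u\<close> is a lattice vector of height below that of \<open>z\<close>, so minimality
      forces its height to be 0.\<close>
    define m where "m = \<lfloor>(n \<bullet> v) / (n \<bullet> z)\<rfloor>"
    define u where "u = v - of_int m *\<^sub>R z"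
    have "v + of_int (- m) *\<^sub>R z \<in> parallel_lattice S"
      using v zS by (intro parallel_lattice_add parallel_lattice_scale S0)
    then have uS: "u \<in> parallel_lattice S" by (simp add: u_def)
    have nu: "n \<bullet> u = n \<bullet> v - m * (n \<bullet> z)" by (simp add: u_def inner_diff_right)
    have "of_int m \<le> (n \<bullet> v) / (n \<bullet> z)" "(n \<bullet> v) / (n \<bullet> z) < of_int m + 1" unfolding m_def by linarith+
    then have "of_int m * (n \<bullet> z) \<le> n \<bullet> v" "n \<bullet> v < (of_int m + 1) * (n \<bullet> z)"
      using z0 by (simp_all add: pos_le_divide_eq pos_divide_less_eq)
    then have nu0: "0 \<le> n \<bullet> u" "n \<bullet> u < n \<bullet> z" using nu by (simp_all add: algebra_simps)
    have "n \<bullet> u = 0"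
    proof (rule ccontr)
      assume "n \<bullet> u \<noteq> 0"
      then obtain u' where "u' \<in> A" "n \<bullet> u' = n \<bullet> u" using reduce[OF uS] nu0 zv0 by auto
      then show False using zmin[of u'] nu0 by simp
    qed
    then have "u \<in> parallel_lattice T" using ker uS by (auto simp: parallel_lattice_def)
    then show "v \<in> {u + of_int m *\<^sub>R z | u m. u \<in> parallel_lattice T}"
      unfolding u_def by (intro CollectI exI[of _ "v - of_int m *\<^sub>R z"] exI[of _ m]) simp
  next
    fix v assume "v \<in> {u + of_int m *\<^sub>R z | u m. u \<in> parallel_lattice T}"
    then show "v \<in> parallel_lattice S"
      using parallel_lattice_mono[OF assms(2)] zS
      by (auto intro!: parallel_lattice_add[OF S0] parallel_lattice_scale[OF S0])
  qed
  moreover have "z \<in> radial_cone S x"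
  proof -
    have nsx: "n \<bullet> (s - x) = n \<bullet> n" using yn(3) nT[OF yT] by (simp add: inner_right_distrib)
    \<comment> \<open>With this \<open>c\<close> the vectors \<open>z\<close> and
      \<open>c *\<^sub>R (s - x)\<close> have the same height, so they differ by a direction of
      \<open>T\<close>, and those are feasible at \<open>x\<close>.\<close>
    define c where "c = (n \<bullet> z) / (n \<bullet> n)"
    have c0: "c \<ge> 0" using z0 nn by (simp add: c_def)
    have "z - c *\<^sub>R (s - x) \<in> parallel_space S"
      using zS parallel_lattice_subset parallel_space_diff[OF s(1) xS]
      by (blast intro: subspace_diff[OF subS] subspace_scale[OF subS])
    moreover have "n \<bullet> (z - c *\<^sub>R (s - x)) = 0"
      using nsx nn by (simp add: inner_diff_right[of _ z] c_def)
    ultimately have "z - c *\<^sub>R (s - x) \<in> radial_cone S x"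
      using ker radial_cone_rel_interior[OF x] radial_cone_mono[OF assms(2)] by blast
    moreover have "s - x \<in> radial_cone S x"
      using s(1) by (auto simp: radial_cone_def intro!: exI[of _ 1])
    ultimately have "(z - c *\<^sub>R (s - x)) + c *\<^sub>R (s - x) \<in> radial_cone S x"
      using radial_cone_add[OF assms(3) xS] radial_cone_scale[OF assms(3) xS] c0 by blast
    then show ?thesis by simp
  qed
  ultimately have "is_ridge_normal T S z"
    using zS xT by (auto simp: is_ridge_normal_def radial_cone_def)
  then show ?thesis by blast
qed

subsection \<open>Local structure of a complex at a ridge\<close>

lemma parallel_space_insert_direction:
  assumes "T \<noteq> {}" "U \<noteq> {}" "parallel_space T \<subseteq> parallel_space U" "v \<in> parallel_space U" "v \<notin> parallel_space T"
  shows "aff_dim T + 1 \<le> aff_dim U"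
proof -
  note sT = subspace_parallel_space[OF assms(1)] and sU = subspace_parallel_space[OF assms(2)]
  have "parallel_space T \<subset> parallel_space U" using assms by blast
  then have "span (parallel_space T) \<subset> span (parallel_space U)"
    using span_eq_iff sT sU by metis
  then have "dim (parallel_space T) < dim (parallel_space U)" by (rule dim_psubset)
  then show ?thesis using dim_parallel_space[OF assms(1)] dim_parallel_space[OF assms(2)] by linarith
qed

lemma parallel_lattice_cong:
  "parallel_space S = parallel_space T \<Longrightarrow> parallel_lattice S = parallel_lattice T"
  by (simp add: parallel_lattice_def)

text \<open>The lattice conditions see only the parallel spaces, so a normal can be carried over to
  parallel cells of another complex once its direction is feasible there.\<close>

lemma is_ridge_normalI:
  assumes "is_ridge_normal T S z" "parallel_space T' = parallel_space T" "parallel_space S' = parallel_space S"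
    and "x \<in> T'" "z \<in> radial_cone S' x"
  shows "is_ridge_normal T' S' z"
  using assms parallel_lattice_cong[OF assms(2)] parallel_lattice_cong[OF assms(3)]
  unfolding is_ridge_normal_def radial_cone_def by auto

lemma is_ridge_normal_uminusI:
  assumes "is_ridge_normal T S z" "parallel_space T' = parallel_space T" "parallel_space S' = parallel_space S"
    and "x \<in> T'" "- z \<in> radial_cone S' x" "S \<noteq> {}"
  shows "is_ridge_normal T' S' (- z)"
proof -
  have "{u + of_int m *\<^sub>R z | u m. u \<in> parallel_lattice T} = {u + of_int m *\<^sub>R (- z) | u m. u \<in> parallel_lattice T}"
  proof (intro equalityI subsetI)
    fix v assume "v \<in> {u + of_int m *\<^sub>R z | u m. u \<in> parallel_lattice T}"
    then obtain u m where "v = u + of_int m *\<^sub>R z" "u \<in> parallel_lattice T" by blast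
    then show "v \<in> {u + of_int m *\<^sub>R (- z) | u m. u \<in> parallel_lattice T}"
      by (intro CollectI exI[of _ u] exI[of _ "- m"]) simp
  next
    fix v assume "v \<in> {u + of_int m *\<^sub>R (- z) | u m. u \<in> parallel_lattice T}"
    then obtain u m where "v = u + of_int m *\<^sub>R (- z)" "u \<in> parallel_lattice T" by blast
    then show "v \<in> {u + of_int m *\<^sub>R z | u m. u \<in> parallel_lattice T}"
      by (intro CollectI exI[of _ u] exI[of _ "- m"]) simp
  qed
  moreover have "- z \<in> parallel_lattice S"
  proof -
    have "z \<in> parallel_lattice S" using assms(1) unfolding is_ridge_normal_def by blast
    then show ?thesis using parallel_lattice_scale[OF assms(6), of z "-1"] by simp
  qed
  ultimately show ?thesis
    using assms parallel_lattice_cong[OF assms(2)] parallel_lattice_cong[OF assms(3)]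
    unfolding is_ridge_normal_def radial_cone_def by auto
qed

text \<open>Modulo the ridge lattice, \<open>z\<close> and \<open>z'\<close> are integer multiples
  of each other. No nonzero multiple of \<open>z\<close> lies in the parallel space of
  \<open>T\<close>, so the product of the two integer factors is 1.\<close>

lemma ridge_normals_same_or_opposite:
  assumes z: "is_ridge_normal T S z" and z': "is_ridge_normal T' S' z'"
    and T: "parallel_space T' = parallel_space T" and S: "parallel_space S' = parallel_space S"
    and "T \<noteq> {}" and nz: "z \<notin> parallel_space T"
  shows "z' - z \<in> parallel_space T \<or> z' + z \<in> parallel_space T"
proof -
  note sT = subspace_parallel_space[OF \<open>T \<noteq> {}\<close>]
  note latT = parallel_lattice_cong[OF T] and latS = parallel_lattice_cong[OF S]
  have "parallel_lattice S' = {u + of_int m *\<^sub>R z' | u m. u \<in> parallel_lattice T'}"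
    and "parallel_lattice S = {u + of_int m *\<^sub>R z | u m. u \<in> parallel_lattice T}"
    and "z \<in> parallel_lattice S" "z' \<in> parallel_lattice S'"
    using z z' unfolding is_ridge_normal_def by blast+
  note eq = this[unfolded latT latS]
  have "z \<in> {u + of_int m *\<^sub>R z' | u m. u \<in> parallel_lattice T}"
    using eq(1,3) by simp
  then obtain u m where u: "z = u + of_int m *\<^sub>R z'" "u \<in> parallel_space T"
    using parallel_lattice_subset by blast
  have "z' \<in> {u + of_int m *\<^sub>R z | u m. u \<in> parallel_lattice T}"
    using eq(2,4) by simp
  then obtain u' m' where u': "z' = u' + of_int m' *\<^sub>R z" "u' \<in> parallel_space T"
    using parallel_lattice_subset by blast
  have "m * m' = 1"
  proof (rule ccontr)
    assume ne: "m * m' \<noteq> 1"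
    have "z = u + of_int m *\<^sub>R u' + (of_int (m * m')) *\<^sub>R z"
      using u(1) unfolding u'(1) by (simp add: scaleR_add_right add.assoc)
    then have e: "(1 - real_of_int (m * m')) *\<^sub>R z = u + of_int m *\<^sub>R u'"
      unfolding scaleR_diff_left by (simp only: scaleR_one diff_eq_eq)
    have r: "(1 - real_of_int (m * m')) \<noteq> 0" using ne by linarith
    have "(1 - real_of_int (m * m')) *\<^sub>R z \<in> parallel_space T"
      unfolding e using u(2) u'(2) sT by (blast intro: subspace_add subspace_scale)
    then have "inverse (1 - real_of_int (m * m')) *\<^sub>R ((1 - real_of_int (m * m')) *\<^sub>R z) \<in> parallel_space T"
      using sT subspace_scale by blast
    then show False using nz r by simp
  qed
  then have "m' = 1 \<or> m' = -1" by (metis zmult_eq_1_iff)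
  then show ?thesis using u' by auto
qed

text \<open>No weights are fixed here, so that the same geometry applies to the given complex and to
  a subvariety's own polyhedral structure.\<close>

locale pure_rational_complex =
  fixes P :: "(real^'d) set set"
  assumes poly: "polyhedral_complex P" and pure: "pure_complex P" and rational: "rational_complex P"
begin

lemma finite_cells: "finite P"
  using poly unfolding polyhedral_complex_def by blast

lemma finite_max_cells: "finite (max_cells P)"
  using finite_cells by (simp add: max_cells_def)

lemma finite_ridges: "finite (ridges P)"
  using finite_cells by (simp add: ridges_def)

lemma cell:
  assumes "S \<in> P"
  shows "polyhedron S" "convex S" "closed S" "S \<noteq> {}"
proof -
  show *: "polyhedron S" "S \<noteq> {}"
    using poly assms unfolding polyhedral_complex_def by blast+
  show "convex S" "closed S"
    using *(1) by (simp_all add: polyhedron_imp_convex polyhedron_imp_closed)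
qed

lemma face_cell: "S \<in> P \<Longrightarrow> F face_of S \<Longrightarrow> F \<noteq> {} \<Longrightarrow> F \<in> P"
  using poly unfolding polyhedral_complex_def by blast

lemma Int_face: "S \<in> P \<Longrightarrow> T \<in> P \<Longrightarrow> (S \<inter> T) face_of S" "S \<in> P \<Longrightarrow> T \<in> P \<Longrightarrow> (S \<inter> T) face_of T"
  using poly unfolding polyhedral_complex_def by blast+

lemma cell_dim_le: "S \<in> P \<Longrightarrow> aff_dim S \<le> complex_dim P"
  using finite_cells by (simp add: complex_dim_def)

lemma max_cell: "S \<in> max_cells P \<Longrightarrow> S \<in> P" "S \<in> max_cells P \<Longrightarrow> aff_dim S = complex_dim P"
  by (auto simp: max_cells_def)

lemma ridge: "S \<in> ridges P \<Longrightarrow> S \<in> P" "S \<in> ridges P \<Longrightarrow> aff_dim S = complex_dim P - 1"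
  by (auto simp: ridges_def)

lemma cell_in_max_cell:
  assumes "S \<in> P"
  shows "\<exists>T\<in>max_cells P. S face_of T"
proof (cases "aff_dim S = complex_dim P")
  case True
  then show ?thesis using assms cell(2)[of S] by (auto simp: max_cells_def face_of_refl)
next
  case False
  then have "aff_dim S < complex_dim P" using cell_dim_le[OF assms] by simp
  then show ?thesis using pure assms unfolding pure_complex_def by blast
qed

lemma Union_max_cells: "\<Union>(max_cells P) = \<Union>P"
proof
  show "\<Union>P \<subseteq> \<Union>(max_cells P)"
  proof
    fix x assume "x \<in> \<Union>P"
    then obtain S where S: "S \<in> P" "x \<in> S" by blast
    then obtain T where "T \<in> max_cells P" "S face_of T" using cell_in_max_cell[OF S(1)] by blast
    then show "x \<in> \<Union>(max_cells P)" using S(2) face_of_imp_subset by blast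
  qed
  show "\<Union>(max_cells P) \<subseteq> \<Union>P" by (auto simp: max_cells_def)
qed

lemma max_cells_nonempty: "max_cells P \<noteq> {}"
proof -
  obtain S where S: "S \<in> P" using poly unfolding polyhedral_complex_def by blast
  then show ?thesis using cell_in_max_cell[OF S] by blast
qed

text \<open>The intersection is a face of \<open>F\<close> meeting the relative interior of
  \<open>F\<close>, and only \<open>F\<close> itself is such a face.\<close>

lemma face_if_rel_interior:
  assumes "F \<in> P" "S \<in> P" "x \<in> rel_interior F" "x \<in> S"
  shows "F face_of S"
proof -
  have "x \<in> (F \<inter> S) \<inter> rel_interior F" using assms rel_interior_subset by blast
  then have "F \<inter> S = F" using face_of_disjoint_rel_interior[OF Int_face(1)[OF assms(1,2)]] by blast
  then show ?thesis using Int_face(2)[OF assms(1,2)] by simp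
qed

lemma max_cells_eqI:
  assumes "S \<in> max_cells P" "T \<in> max_cells P" "complex_dim P \<le> aff_dim (S \<inter> T)"
  shows "S = T"
proof -
  note ST = max_cell(1)[OF assms(1)] max_cell(1)[OF assms(2)]
  have "S \<inter> T = S"
    using face_of_aff_dim_lt[OF cell(2)[OF ST(1)] Int_face(1)[OF ST]] assms max_cell(2)[of S] by force
  moreover have "S \<inter> T = T"
    using face_of_aff_dim_lt[OF cell(2)[OF ST(2)] Int_face(2)[OF ST]] assms max_cell(2)[of T] by force
  ultimately show ?thesis by simp
qed

lemma rel_interior_max_cell_unique:
  assumes "S \<in> max_cells P" "T \<in> P" "x \<in> rel_interior S" "x \<in> T"
  shows "T = S"
proof (rule ccontr)
  assume "T \<noteq> S"
  have "S face_of T"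
    using face_if_rel_interior[OF max_cell(1)[OF assms(1)] assms(2-4)] .
  then have "aff_dim S < aff_dim T"
    using face_of_aff_dim_lt[OF cell(2)[OF assms(2)], of S] \<open>T \<noteq> S\<close> by simp
  then show False using cell_dim_le[OF assms(2)] max_cell(2)[OF assms(1)] by simp
qed

text \<open>Take a cell of least dimension through \<open>x\<close>: were \<open>x\<close> on its
  relative frontier, a proper face through \<open>x\<close> would be a smaller cell.\<close>

lemma rel_interior_cell:
  assumes "x \<in> \<Union>P"
  obtains F where "F \<in> P" "x \<in> rel_interior F"
proof -
  \<comment> \<open>Since \<open>aff_dim\<close> is at least -1, the shift keeps \<open>nat\<close>
    strictly monotone on the values that occur.\<close>
  define n where "n F = nat (aff_dim F + 1)" for F :: "(real^'d) set"
  obtain F where F: "F \<in> P" "x \<in> F" and min: "\<And>G. G \<in> P \<Longrightarrow> x \<in> G \<Longrightarrow> n F \<le> n G"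
  proof -
    obtain F0 where "F0 \<in> P \<and> x \<in> F0" using assms by blast
    from ex_has_least_nat[of "\<lambda>F. F \<in> P \<and> x \<in> F", OF this, of n]
    show ?thesis using that by blast
  qed
  have "x \<in> rel_interior F"
  proof (rule ccontr)
    assume "x \<notin> rel_interior F"
    then have "x \<in> rel_frontier F" using F cell(3)[OF F(1)] by (simp add: rel_frontier_def)
    then obtain G where G: "G face_of F" "G \<noteq> F" "x \<in> G"
      using rel_frontier_of_polyhedron_alt[OF cell(1)[OF F(1)]] by auto
    then have "aff_dim G < aff_dim F"
      using face_of_aff_dim_lt[OF cell(2)[OF F(1)] G(1)] by simp
    moreover have "-1 \<le> aff_dim G" by (rule aff_dim_geq)
    moreover have "G \<in> P" using face_cell F G by blast
    ultimately show False using min[of G] G by (simp add: n_def)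
  qed
  then show thesis using that F by blast
qed

text \<open>Transports a direction from a convex set inside the complex, typically a cell of another
  complex, to a maximal cell: finitely many closed cells cover the short segment.\<close>

lemma ray_in_max_cell:
  assumes "convex S" "S \<subseteq> \<Union>P" "x \<in> S" "v \<in> radial_cone S x"
  obtains T where "T \<in> max_cells P" "x \<in> T" "v \<in> radial_cone T x"
proof -
  obtain e where e: "e > 0" "x + e *\<^sub>R v \<in> S" using assms(4) by (auto simp: radial_cone_def)
  have "x + t *\<^sub>R v \<in> \<Union>(max_cells P)" if "0 < t" "t \<le> e" for t
    using radial_cone_shrink[OF assms(1,3) e(2), of t] that assms(2) Union_max_cells by auto
  moreover have "closed T" if "T \<in> max_cells P" for T using cell(3) max_cell(1) that by blast
  ultimately obtain T where "T \<in> max_cells P" "x \<in> T" "v \<in> radial_cone T x"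
    using radial_cone_Union[OF finite_max_cells _ e(1)] by blast
  then show thesis by (rule that)
qed

lemma ridge_normal:
  assumes "T \<in> ridges P" "S \<in> max_cells P" "T face_of S"
  shows "is_ridge_normal T S (ridge_normal T S)"
proof -
  have "\<exists>z. is_ridge_normal T S z"
  proof (rule is_ridge_normal_exists)
    show "T \<noteq> {}" "convex T" using cell ridge(1)[OF assms(1)] by auto
    show "convex S" using cell max_cell(1)[OF assms(2)] by auto
    show "aff_dim S = aff_dim T + 1" using ridge(2)[OF assms(1)] max_cell(2)[OF assms(2)] by simp
  qed (use assms rational in \<open>auto simp: rational_complex_def face_of_imp_subset\<close>)
  then show ?thesis unfolding ridge_normal_def by (rule someI_ex)
qed

section \<open>A maximal cell near a relative interior point of one of its ridges\<close>

context
  fixes T S z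
  assumes T: "T \<in> ridges P" and S: "S \<in> max_cells P" and TS: "T face_of S" and z: "is_ridge_normal T S z"
begin

text \<open>By rationality, lattice vectors span the parallel space of \<open>S\<close>, and each of
  them is a ridge lattice vector plus a multiple of \<open>z\<close>.\<close>

lemma parallel_space_max_cell: "parallel_space S = {l + s *\<^sub>R z | l s. l \<in> parallel_space T}"
proof
  have S0: "S \<noteq> {}" and T0: "T \<noteq> {}" using cell ridge(1)[OF T] max_cell(1)[OF S] by auto
  note sS = subspace_parallel_space[OF S0] and sT = subspace_parallel_space[OF T0]
  have zS: "z \<in> parallel_space S" using z parallel_lattice_subset unfolding is_ridge_normal_def by blast
  have TS': "parallel_space T \<subseteq> parallel_space S" using TS parallel_space_mono face_of_imp_subset by blast
  show "{l + s *\<^sub>R z | l s. l \<in> parallel_space T} \<subseteq> parallel_space S"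
  proof
    fix v assume "v \<in> {l + s *\<^sub>R z | l s. l \<in> parallel_space T}"
    then obtain l s where "v = l + s *\<^sub>R z" "l \<in> parallel_space S" using TS' by blast
    then show "v \<in> parallel_space S" using subspace_add[OF sS] subspace_scale[OF sS zS] by simp
  qed
  have "lattice_has_rank (parallel_lattice S) (nat (aff_dim S))"
    using rational S unfolding rational_complex_def by blast
  from parallel_lattice_spans[OF S0 this]
  obtain B where B: "B \<subseteq> parallel_lattice S" "span B = parallel_space S" .
  have "B \<subseteq> {l + s *\<^sub>R z | l s. l \<in> parallel_space T}"
  proof
    fix b assume "b \<in> B"
    then have "b \<in> {u + of_int m *\<^sub>R z | u m. u \<in> parallel_lattice T}"
      using B(1) z[unfolded is_ridge_normal_def] by blast
    then show "b \<in> {l + s *\<^sub>R z | l s. l \<in> parallel_space T}" using parallel_lattice_subset by blast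
  qed
  moreover have "subspace {l + s *\<^sub>R z | l s. l \<in> parallel_space T}"
  proof -
    have "{l + s *\<^sub>R z | l s. l \<in> parallel_space T} = {l + k |l k. l \<in> parallel_space T \<and> k \<in> span {z}}"
      by (auto simp: span_singleton)
    then show ?thesis using subspace_sums[OF sT subspace_span[of "{z}"]] by argo
  qed
  ultimately show "parallel_space S \<subseteq> {l + s *\<^sub>R z | l s. l \<in> parallel_space T}"
    unfolding B(2)[symmetric] by (rule span_minimal)
qed

lemma ridge_normal_notin: "z \<notin> parallel_space T"
proof
  assume zT: "z \<in> parallel_space T"
  have S0: "S \<noteq> {}" and T0: "T \<noteq> {}" using cell ridge(1)[OF T] max_cell(1)[OF S] by auto
  note sT = subspace_parallel_space[OF T0]
  have "parallel_space S \<subseteq> parallel_space T"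
  proof
    fix v assume "v \<in> parallel_space S"
    then obtain l s where "v = l + s *\<^sub>R z" "l \<in> parallel_space T"
      unfolding parallel_space_max_cell by blast
    then show "v \<in> parallel_space T" using subspace_add[OF sT] subspace_scale[OF sT zT] by simp
  qed
  then have "dim (parallel_space S) \<le> dim (parallel_space T)" by (rule dim_subset)
  then show False
    using dim_parallel_space[OF S0] dim_parallel_space[OF T0] ridge(2)[OF T] max_cell(2)[OF S] by linarith
qed

context
  fixes x
  assumes x: "x \<in> rel_interior T"
begin

lemma ridge_point: "x \<in> T" "x \<in> S"
  using x rel_interior_subset TS face_of_imp_subset by blast+

lemma ridge_directions: "parallel_space T \<subseteq> radial_cone S x"
  using radial_cone_rel_interior[OF x] radial_cone_mono[OF face_of_imp_subset[OF TS]] by blast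

lemma normal_radial: "z \<in> radial_cone S x"
  by (rule is_ridge_normal_radial_cone[OF z face_of_imp_subset[OF TS] cell(2)[OF max_cell(1)[OF S]] x])

text \<open>A direction with negative coefficient would make \<open>- z\<close> feasible besides
  \<open>z\<close>; then \<open>radial_cone_face\<close> would place \<open>z\<close> in the span of
  the face \<open>T\<close>. This half space is the local model at every ridge.\<close>

lemma radial_cone_half_space: "radial_cone S x = {l + s *\<^sub>R z | l s. l \<in> parallel_space T \<and> 0 \<le> s}"
proof (intro equalityI subsetI)
  note cS = cell(2)[OF max_cell(1)[OF S]]
  have sT: "subspace (parallel_space T)" using subspace_parallel_space cell(4) ridge(1)[OF T] by blast
  show "v \<in> radial_cone S x" if "v \<in> {l + s *\<^sub>R z | l s. l \<in> parallel_space T \<and> 0 \<le> s}" for v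
  proof -
    obtain l s where "v = l + s *\<^sub>R z" "l \<in> radial_cone S x" "0 \<le> s"
      using \<open>v \<in> {l + s *\<^sub>R z | l s. l \<in> parallel_space T \<and> 0 \<le> s}\<close> ridge_directions by blast
    then show ?thesis
      using radial_cone_add[OF cS ridge_point(2)] radial_cone_scale[OF cS ridge_point(2) normal_radial] by simp
  qed
  fix v assume v: "v \<in> radial_cone S x"
  then have "v \<in> parallel_space S" using radial_cone_subset_parallel_space[OF ridge_point(2)] by blast
  then obtain l s where ls: "v = l + s *\<^sub>R z" "l \<in> parallel_space T" using parallel_space_max_cell by blast
  have "s \<ge> 0"
  proof (rule ccontr)
    assume "\<not> s \<ge> 0"
    then have s: "s < 0" by simp
    have "- l \<in> parallel_space T" using ls(2) sT subspace_neg by blast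
    then have "v + (- l) \<in> radial_cone S x"
      using radial_cone_add[OF cS ridge_point(2) v] ridge_directions by blast
    then have "(1 / (- s)) *\<^sub>R (v + (- l)) \<in> radial_cone S x"
      using s by (intro radial_cone_scale[OF cS ridge_point(2)]) auto
    then have "- z \<in> radial_cone S x" using s ls(1) by simp
    then have "z \<in> radial_cone T x"
      using radial_cone_face[OF TS cS ridge_point(1) normal_radial] by blast
    then show False using ridge_normal_notin radial_cone_rel_interior[OF x] by blast
  qed
  then show "v \<in> {l + s *\<^sub>R z | l s. l \<in> parallel_space T \<and> 0 \<le> s}" using ls by blast
qed

lemma minus_normal_notin:
  assumes "z + z' \<in> parallel_space T"
  shows "z' \<notin> radial_cone S x"
proof
  have sT: "subspace (parallel_space T)" using subspace_parallel_space cell(4) ridge(1)[OF T] by blast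
  assume "z' \<in> radial_cone S x"
  then obtain l s where ls: "z' = l + s *\<^sub>R z" "l \<in> parallel_space T" "s \<ge> 0"
    using radial_cone_half_space by blast
  have "(z + z') - l \<in> parallel_space T" using subspace_diff[OF sT assms ls(2)] .
  then have "(1 + s) *\<^sub>R z \<in> parallel_space T" using ls(1) by (simp add: algebra_simps)
  then have "(1 / (1 + s)) *\<^sub>R ((1 + s) *\<^sub>R z) \<in> parallel_space T" using sT subspace_scale by blast
  then show False using ridge_normal_notin ls(3) by simp
qed

lemma transverse_direction:
  assumes "v \<in> radial_cone S x" "v \<notin> parallel_space T"
  obtains s where "s > 0" "v - s *\<^sub>R z \<in> parallel_space T"
proof -
  obtain l s where ls: "v = l + s *\<^sub>R z" "l \<in> parallel_space T" "s \<ge> 0"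
    using assms(1) radial_cone_half_space by blast
  then have "s \<noteq> 0" using assms(2) by auto
  then show thesis using that[of s] ls by simp
qed

end

text \<open>The opposite sign is excluded because both normals point into \<open>S\<close>. In
  particular the choice made in \<open>ridge_normal\<close> does not affect balancing.\<close>

lemma ridge_normal_unique:
  assumes z': "is_ridge_normal T S z'"
  shows "z' - z \<in> parallel_space T"
proof -
  have T0: "T \<noteq> {}" using cell(4) ridge(1)[OF T] by blast
  obtain x where x: "x \<in> rel_interior T" using T0 rel_interior_eq_empty cell(2) ridge(1)[OF T] by blast
  have "z' \<in> radial_cone S x"
    by (rule is_ridge_normal_radial_cone[OF z' face_of_imp_subset[OF TS] cell(2)[OF max_cell(1)[OF S]] x])
  then have "z' + z \<notin> parallel_space T" using minus_normal_notin[OF x] by (metis add.commute)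
  then show ?thesis
    using ridge_normals_same_or_opposite[OF z z' refl refl T0 ridge_normal_notin] by blast
qed

end

text \<open>The intersection contains the ridge and a direction leaving it, so it has full
  dimension, whereas distinct maximal cells meet in faces of smaller dimension.\<close>

lemma unique_max_cell_direction:
  assumes "T \<in> ridges P" "x \<in> rel_interior T" "S1 \<in> max_cells P" "S2 \<in> max_cells P" "x \<in> S1" "x \<in> S2"
    and "v \<in> radial_cone S1 x" "v \<in> radial_cone S2 x" "v \<notin> parallel_space T"
  shows "S1 = S2"
proof (rule max_cells_eqI[OF assms(3,4)])
  have S12: "S1 \<in> P" "S2 \<in> P" "T \<in> P" using assms max_cell(1) ridge(1) by auto
  have "T \<subseteq> S1 \<inter> S2"
    using face_if_rel_interior[OF S12(3)] S12 assms face_of_imp_subset by blast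
  moreover have "v \<in> parallel_space (S1 \<inter> S2)"
    using radial_cone_Int[OF cell(2)[OF S12(1)] cell(2)[OF S12(2)]] assms
      radial_cone_subset_parallel_space[of x "S1 \<inter> S2"] by blast
  ultimately have "aff_dim T + 1 \<le> aff_dim (S1 \<inter> S2)"
    using assms cell(4)[OF S12(3)] by (intro parallel_space_insert_direction[of _ _ v] parallel_space_mono) auto
  then show "complex_dim P \<le> aff_dim (S1 \<inter> S2)" using ridge(2)[OF assms(1)] by simp
qed

end

subsection \<open>The balanced map induced by a subvariety\<close>

text \<open>Only the underlying sets are nested: a cell of \<open>Q\<close> may spread over several
  cells of \<open>P\<close>, and conversely.\<close>

locale tropical_subcomplex = P: pure_rational_complex P + Q: pure_rational_complex Q
  for P Q :: "(real^'d) set set" +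
  fixes u :: "(real^'d) set \<Rightarrow> real"
  assumes dim_eq: "complex_dim Q = complex_dim P" and sub: "\<Union>Q \<subseteq> \<Union>P"
    and bal: "u \<in> balanced_maps Q" and u_pos: "\<And>q. q \<in> max_cells Q \<Longrightarrow> 0 < u q"
begin

definition overlap :: "(real^'d) set \<Rightarrow> (real^'d) set \<Rightarrow> bool" where
  "overlap q S \<longleftrightarrow> aff_dim (q \<inter> S) = complex_dim P"

lemma cells:
  assumes "q \<in> max_cells Q"
  shows "q \<in> Q" "convex q" "closed q" "q \<noteq> {}" "aff_dim q = complex_dim P" "q \<subseteq> \<Union>P"
  using Q.max_cell[OF assms] Q.cell[of q] dim_eq sub by auto

text \<open>Near \<open>x\<close> the intersection contains all directions of \<open>T\<close> and
  one more, which forces full dimension.\<close>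

lemma overlapI:
  assumes "q \<in> max_cells Q" "S \<in> max_cells P" "x \<in> q" "x \<in> S"
    and "T \<noteq> {}" "aff_dim T = complex_dim P - 1"
    and "parallel_space T \<subseteq> radial_cone q x" "parallel_space T \<subseteq> radial_cone S x"
    and "v \<in> radial_cone q x" "v \<in> radial_cone S x" "v \<notin> parallel_space T"
  shows "overlap q S"
proof -
  have "radial_cone (q \<inter> S) x = radial_cone q x \<inter> radial_cone S x"
    using radial_cone_Int[OF cells(2)[OF assms(1)] P.cell(2)[OF P.max_cell(1)[OF assms(2)]] assms(3,4)] .
  moreover have "radial_cone (q \<inter> S) x \<subseteq> parallel_space (q \<inter> S)"
    using radial_cone_subset_parallel_space[of x "q \<inter> S"] assms(3,4) by blast
  ultimately have "aff_dim T + 1 \<le> aff_dim (q \<inter> S)"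
    using assms by (intro parallel_space_insert_direction[of T "q \<inter> S" v]) auto
  moreover have "aff_dim (q \<inter> S) \<le> aff_dim q" by (rule aff_dim_subset) simp
  ultimately show ?thesis using assms(6) cells(5)[OF assms(1)] by (simp add: overlap_def)
qed

text \<open>Away from codimension two the weight does not change when leaving a cell inside \<open>S\<close>: across a
  ridge inside \<open>S\<close>, balancing forces exactly two cells on opposite sides, with equal weights.\<close>

lemma continue_in_direction:
  assumes S: "S \<in> max_cells P" and xS: "x \<in> rel_interior S" and q: "q \<in> max_cells Q" and xq: "x \<in> q"
    and low: "\<And>B. B \<in> Q \<Longrightarrow> aff_dim B < complex_dim P - 1 \<Longrightarrow> x \<notin> B"
    and w: "w \<in> parallel_space S"
  shows "\<exists>q'\<in>max_cells Q. x \<in> q' \<and> u q' = u q \<and> w \<in> radial_cone q' x"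
proof -
  note SP = P.max_cell(1)[OF S]
  note sS = subspace_parallel_space[OF P.cell(4)[OF SP]]
  \<comment> \<open>\<open>S\<close> is the only cell of \<open>P\<close> through \<open>x\<close>,
    so a direction of \<open>r\<close>, which stays inside the union of \<open>P\<close>, is a
    direction of \<open>S\<close>.\<close>
  have inS: "radial_cone r x \<subseteq> parallel_space S" if r: "r \<in> max_cells Q" "x \<in> r" for r
  proof
    fix v assume v: "v \<in> radial_cone r x"
    obtain T where T: "T \<in> max_cells P" "x \<in> T" "v \<in> radial_cone T x"
      using P.ray_in_max_cell[OF cells(2)[OF r(1)] cells(6)[OF r(1)] r(2) v] .
    have "T = S" using P.rel_interior_max_cell_unique[OF S P.max_cell(1)[OF T(1)] xS T(2)] .
    then show "v \<in> parallel_space S" using T(3) radial_cone_rel_interior[OF xS] by simp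
  qed
  have eqS: "parallel_space r = parallel_space S"
    if "r \<in> max_cells Q" "parallel_space r \<subseteq> parallel_space S" for r
    by (rule parallel_space_eqI[OF cells(4)[OF that(1)] P.cell(4)[OF SP] that(2)])
      (simp add: cells(5)[OF that(1)] P.max_cell(2)[OF S])
  have "x \<in> \<Union>Q" using xq cells(1)[OF q] by blast
  then obtain F where F: "F \<in> Q" "x \<in> rel_interior F" by (rule Q.rel_interior_cell)
  have xF: "x \<in> F" using F(2) rel_interior_subset by blast
  have "aff_dim F \<ge> complex_dim P - 1" using low[OF F(1)] xF by force
  then consider "aff_dim F = complex_dim P" | "aff_dim F = complex_dim P - 1"
    using Q.cell_dim_le[OF F(1)] dim_eq by linarith
  then show ?thesis
  proof cases
    case 1
    then have Fm: "F \<in> max_cells Q" using F(1) dim_eq by (simp add: max_cells_def)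
    have "q = F" using Q.rel_interior_max_cell_unique[OF Fm cells(1)[OF q] F(2) xq] .
    then have rc: "radial_cone q x = parallel_space q" using radial_cone_rel_interior[OF F(2)] by simp
    then have "w \<in> radial_cone q x" using eqS[OF q] inS[OF q xq] w by simp
    then show ?thesis using q xq by blast
  next
    case 2
    then have Fr: "F \<in> ridges Q" using F(1) dim_eq by (simp add: ridges_def)
    have sF: "subspace (parallel_space F)" using subspace_parallel_space[OF Q.cell(4)[OF F(1)]] .
    define A where "A = {r \<in> max_cells Q. F face_of r}"
    have finA: "finite A" using Q.finite_max_cells by (simp add: A_def)
    have Ax: "x \<in> r" if "r \<in> A" for r using that xF face_of_imp_subset by (auto simp: A_def)
    have qA: "q \<in> A" using Q.face_if_rel_interior[OF F(1) cells(1)[OF q] F(2) xq] q by (simp add: A_def)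
    define \<zeta> where "\<zeta> = ridge_normal F"
    have \<zeta>: "is_ridge_normal F r (\<zeta> r)" if "r \<in> A" for r
      using that Q.ridge_normal[OF Fr] by (simp add: A_def \<zeta>_def)
    have half: "radial_cone r x = {l + s *\<^sub>R \<zeta> r | l s. l \<in> parallel_space F \<and> 0 \<le> s}"
      and psp: "parallel_space r = {l + s *\<^sub>R \<zeta> r | l s. l \<in> parallel_space F}"
      and notin: "\<zeta> r \<notin> parallel_space F"
      and rcz: "\<zeta> r \<in> radial_cone r x" and rcF: "parallel_space F \<subseteq> radial_cone r x" if r: "r \<in> A" for r
    proof -
      have r': "r \<in> max_cells Q" "F face_of r" using r by (auto simp: A_def)
      show "radial_cone r x = {l + s *\<^sub>R \<zeta> r | l s. l \<in> parallel_space F \<and> 0 \<le> s}"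
        using Q.radial_cone_half_space[OF Fr r' \<zeta>[OF r] F(2)] .
      show "parallel_space r = {l + s *\<^sub>R \<zeta> r | l s. l \<in> parallel_space F}"
        using Q.parallel_space_max_cell[OF Fr r' \<zeta>[OF r]] .
      show "\<zeta> r \<notin> parallel_space F" using Q.ridge_normal_notin[OF Fr r' \<zeta>[OF r]] .
      show "\<zeta> r \<in> radial_cone r x" using Q.normal_radial[OF Fr r' \<zeta>[OF r] F(2)] .
      show "parallel_space F \<subseteq> radial_cone r x" using Q.ridge_directions[OF Fr r' \<zeta>[OF r] F(2)] .
    qed
    have pS: "parallel_space r = parallel_space S" if r: "r \<in> A" for r
    proof (rule eqS)
      show rm: "r \<in> max_cells Q" using r by (simp add: A_def)
      have "\<zeta> r \<in> parallel_space S" "parallel_space F \<subseteq> parallel_space S"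
        using inS[OF rm Ax[OF r]] rcz[OF r] rcF[OF r] by auto
      then show "parallel_space r \<subseteq> parallel_space S"
        unfolding psp[OF r] using subspace_add[OF sS] subspace_scale[OF sS] by fastforce
    qed
    have uniq: "r = r'" if "r \<in> A" "r' \<in> A" "\<zeta> r - \<zeta> r' \<in> parallel_space F" for r r'
    proof (rule Q.unique_max_cell_direction[OF Fr F(2), of r r' "\<zeta> r"])
      show "r \<in> max_cells Q" "r' \<in> max_cells Q" "x \<in> r" "x \<in> r'" using that Ax by (auto simp: A_def)
      show "\<zeta> r \<in> radial_cone r x" "\<zeta> r \<notin> parallel_space F" using rcz notin that by auto
      show "\<zeta> r \<in> radial_cone r' x" unfolding half[OF that(2)]
        using that(3) by (intro CollectI exI[of _ "\<zeta> r - \<zeta> r'"] exI[of _ 1]) simp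
    qed
    \<comment> \<open>All cells at \<open>F\<close> have the same parallel space as
      \<open>S\<close>, so a normal equals that of \<open>q\<close> up to sign modulo
      \<open>F\<close>; equal signs would make the cells coincide.\<close>
    have opp: "\<zeta> r + \<zeta> q \<in> parallel_space F" if "r \<in> A" "r \<noteq> q" for r
      using ridge_normals_same_or_opposite[OF \<zeta>[OF qA] \<zeta>[OF that(1)] refl _ Q.cell(4)[OF F(1)] notin[OF qA]]
        pS[OF qA] pS[OF that(1)] uniq[OF that(1) qA] that(2) by metis
    obtain l s where ls: "w = l + s *\<^sub>R \<zeta> q" "l \<in> parallel_space F"
      using w pS[OF qA] psp[OF qA] by blast
    show ?thesis
    proof (cases "s \<ge> 0")
      case True
      then have "w \<in> radial_cone q x" unfolding half[OF qA] using ls by blast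
      then show ?thesis using q xq by blast
    next
      case False
      have "(\<Sum>r\<in>A. u r *\<^sub>R \<zeta> r) \<in> parallel_space F"
        using bal Fr unfolding balanced_maps_def A_def \<zeta>_def by blast
      then have 1: "u q *\<^sub>R \<zeta> q + (\<Sum>r\<in>A - {q}. u r *\<^sub>R \<zeta> r) \<in> parallel_space F"
        using sum.remove[OF finA qA, of "\<lambda>r. u r *\<^sub>R \<zeta> r"] by simp
      have 2: "(\<Sum>r\<in>A - {q}. u r *\<^sub>R (\<zeta> r + \<zeta> q)) \<in> parallel_space F"
        using opp by (intro subspace_sum[OF sF] subspace_scale[OF sF]) auto
      \<comment> \<open>Modulo the span of \<open>F\<close> every other normal is
        \<open>- \<zeta> q\<close>, so balancing becomes a scalar equation between weights.\<close>
      have "(u q - (\<Sum>r\<in>A - {q}. u r)) *\<^sub>R \<zeta> q \<in> parallel_space F"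
        using subspace_diff[OF sF 1 2]
        by (simp add: scaleR_add_right sum.distrib scaleR_diff_left scaleR_sum_left)
      then have "inverse (u q - (\<Sum>r\<in>A - {q}. u r)) *\<^sub>R ((u q - (\<Sum>r\<in>A - {q}. u r)) *\<^sub>R \<zeta> q) \<in> parallel_space F"
        by (rule subspace_scale[OF sF])
      then have "u q - (\<Sum>r\<in>A - {q}. u r) = 0"
        using notin[OF qA] by (cases "u q - (\<Sum>r\<in>A - {q}. u r) = 0") simp_all
      then have uq: "u q = (\<Sum>r\<in>A - {q}. u r)" by simp
      \<comment> \<open>Positivity of \<open>u q\<close> provides a cell across the ridge. Two such
        cells would have equal normals modulo \<open>F\<close>, so there is exactly one, and it
        carries the whole weight.\<close>
      have "A - {q} \<noteq> {}" using uq u_pos[OF q] by (metis less_irrefl sum.empty)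
      then obtain q' where q': "q' \<in> A" "q' \<noteq> q" by blast
      have "A - {q} = {q'}"
      proof -
        have "r = q'" if r: "r \<in> A" "r \<noteq> q" for r
        proof (rule uniq[OF r(1) q'(1)])
          show "\<zeta> r - \<zeta> q' \<in> parallel_space F"
            using subspace_diff[OF sF opp[OF r] opp[OF q']] by simp
        qed
        then show ?thesis using q' by blast
      qed
      then have "u q = u q'" using uq by simp
      moreover have "w \<in> radial_cone q' x"
      proof -
        have "l + s *\<^sub>R (\<zeta> q' + \<zeta> q) \<in> parallel_space F"
          by (rule subspace_add[OF sF ls(2) subspace_scale[OF sF opp[OF q']]])
        moreover have "w = (l + s *\<^sub>R (\<zeta> q' + \<zeta> q)) + (- s) *\<^sub>R \<zeta> q'"
          by (simp add: ls(1) scaleR_add_right)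
        moreover have "0 \<le> - s" using False by simp
        ultimately show ?thesis unfolding half[OF q'(1)] by blast
      qed
      ultimately show ?thesis using q'(1) Ax[OF q'(1)] by (auto simp: A_def)
    qed
  qed
qed

lemma generic_point:
  assumes "convex U" "aff_dim U = complex_dim P"
  obtains x where "x \<in> U" "\<And>B. B \<in> Q \<Longrightarrow> aff_dim B < complex_dim P \<Longrightarrow> x \<notin> B"
proof -
  obtain S where "S \<in> P" "aff_dim S = complex_dim P" using P.max_cells_nonempty P.max_cell by blast
  then have "0 \<le> complex_dim P"
    using P.cell(4)[of S] aff_dim_geq[of S] aff_dim_empty[of S] by linarith
  then have "U \<noteq> {}" using assms(2) aff_dim_empty[of U] by linarith
  moreover have "finite {B \<in> Q. aff_dim B < complex_dim P}" using Q.finite_cells by simp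
  ultimately obtain x where "x \<in> U" "\<And>B. B \<in> {B \<in> Q. aff_dim B < complex_dim P} \<Longrightarrow> x \<notin> B"
    using convex_avoid_low_dim[OF _ assms(1), of "{B \<in> Q. aff_dim B < complex_dim P}"] assms(2) by auto
  then show thesis using that by simp
qed

text \<open>Walk from a generic point of the overlap to \<open>p\<close> and take the last parameter
  whose point lies in a cell of weight \<open>u q\<close>. It exists because these cells are closed,
  and \<open>continue_in_direction\<close> pushes it further unless it is already the end
  \<open>p\<close>.\<close>

lemma weight_at_generic_point:
  assumes S: "S \<in> max_cells P" and q: "q \<in> max_cells Q" and ov: "overlap q S"
    and p: "p \<in> rel_interior S" and low: "\<And>B. B \<in> Q \<Longrightarrow> aff_dim B < complex_dim P \<Longrightarrow> p \<notin> B"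
  shows "\<exists>q'\<in>max_cells Q. p \<in> q' \<and> u q' = u q"
proof -
  note cS = P.cell(2)[OF P.max_cell(1)[OF S]]
  define U where "U = rel_interior (q \<inter> S)"
  have cqS: "convex (q \<inter> S)" using cells(2)[OF q] cS by (rule convex_Int)
  have hullU: "affine hull U = affine hull (q \<inter> S)"
    unfolding U_def by (rule rel_interior_same_affine_hull[OF cqS])
  then have dimU: "aff_dim U = complex_dim P"
    using ov aff_dim_affine_hull unfolding overlap_def by metis
  have cU: "convex U" unfolding U_def using cqS by (rule convex_rel_interior)
  have US: "U \<subseteq> rel_interior S"
  proof -
    have "q \<inter> S \<noteq> {}" using generic_point[OF cU dimU] rel_interior_subset unfolding U_def by blast
    then have "affine hull (q \<inter> S) = affine hull S"
      using ov P.max_cell(2)[OF S] unfolding overlap_def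
      by (intro affine_dim_equal) (auto intro: hull_mono[THEN subsetD])
    then show ?thesis unfolding U_def by (intro subset_rel_interior) auto
  qed
  \<comment> \<open>If the segment from \<open>y\<close> met a cell \<open>B\<close> of codimension
    at least two before reaching \<open>p\<close>, then \<open>y\<close> would lie in the affine
    hull of \<open>p\<close> and \<open>B\<close>. These hulls have smaller dimension than
    \<open>U\<close>, so \<open>y\<close> can be chosen outside all of them.\<close>
  define \<A> where "\<A> = (\<lambda>B. affine hull (insert p B)) ` {B \<in> Q. aff_dim B < complex_dim P - 1}"
  have "finite \<A>" using Q.finite_cells by (simp add: \<A>_def)
  moreover have "aff_dim A < aff_dim U" if "A \<in> \<A>" for A
    using that dimU by (auto simp: \<A>_def aff_dim_insert)
  moreover have "U \<noteq> {}" using generic_point[OF cU dimU] by blast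
  ultimately obtain y where y: "y \<in> U" "\<And>A. A \<in> \<A> \<Longrightarrow> y \<notin> A"
    using convex_avoid_low_dim[OF _ cU] by blast
  define g where "g t = y + t *\<^sub>R (p - y)" for t :: real
  define X where "X = \<Union>{q' \<in> max_cells Q. u q' = u q}"
  define I where "I = {0..1} \<inter> g -` X"
  have "closed X" unfolding X_def using Q.finite_max_cells cells(3) by (intro closed_Union) auto
  then have "closed (g -` X)"
    by (rule continuous_closed_vimage) (auto simp: g_def[abs_def] intro!: continuous_intros)
  then have "compact I" unfolding I_def by (intro compact_Int_closed) auto
  moreover have "0 \<in> I"
    using y(1) q rel_interior_subset[of "q \<inter> S"] by (auto simp: I_def g_def X_def U_def)
  ultimately obtain t where t: "t \<in> I" and tmax: "\<And>s. s \<in> I \<Longrightarrow> s \<le> t"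
    using compact_attains_sup[of I] by blast
  have t01: "0 \<le> t" "t \<le> 1" using t by (auto simp: I_def)
  have "t = 1"
  proof (rule ccontr)
    assume "t \<noteq> 1"
    then have t1: "t < 1" using t01 by simp
    obtain r where r: "r \<in> max_cells Q" "u r = u q" "g t \<in> r" using t by (auto simp: I_def X_def)
    have gS: "g t \<in> rel_interior S"
    proof -
      have "(1 - t) *\<^sub>R y + t *\<^sub>R p \<in> rel_interior S"
        using convexD[OF convex_rel_interior[OF cS], of y p "1 - t" t] y(1) US p t01 by auto
      then show ?thesis by (simp add: g_def algebra_simps)
    qed
    have glow: "g t \<notin> B" if B: "B \<in> Q" "aff_dim B < complex_dim P - 1" for B
    proof
      assume "g t \<in> B"
      then have "(1 / (1 - t)) *\<^sub>R g t + (- t / (1 - t)) *\<^sub>R p \<in> affine hull (insert p B)"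
        using t1 by (intro mem_affine[OF affine_affine_hull] hull_inc) (auto simp: divide_simps)
      also have "(1 / (1 - t)) *\<^sub>R g t + (- t / (1 - t)) *\<^sub>R p = (1 / (1 - t)) *\<^sub>R (g t - t *\<^sub>R p)"
        by (simp add: scaleR_diff_right)
      also have "g t - t *\<^sub>R p = (1 - t) *\<^sub>R y" by (simp add: g_def algebra_simps)
      finally have "y \<in> affine hull (insert p B)" using t1 by simp
      then show False using y(2)[of "affine hull (insert p B)"] B by (auto simp: \<A>_def)
    qed
    have "p - y \<in> parallel_space S"
      using p y(1) US rel_interior_subset by (blast intro: parallel_space_diff)
    then obtain r' where r': "r' \<in> max_cells Q" "g t \<in> r'" "u r' = u r" "p - y \<in> radial_cone r' (g t)"
      using continue_in_direction[OF S gS r(1,3) glow] by blast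
    obtain e where e: "e > 0" "g t + e *\<^sub>R (p - y) \<in> r'" using r'(4) by (auto simp: radial_cone_def)
    define d where "d = min e (1 - t)"
    have d: "d > 0" "d \<le> e" "t + d \<le> 1" using e t1 by (auto simp: d_def)
    have "g t + d *\<^sub>R (p - y) \<in> r'"
      using radial_cone_shrink[OF cells(2)[OF r'(1)] r'(2) e(2), of d] d by simp
    then have "g (t + d) \<in> r'" by (simp add: g_def algebra_simps)
    then have "t + d \<in> I" using d t01 r' r by (auto simp: I_def X_def)
    then show False using tmax d by force
  qed
  then have "p \<in> X" using t by (simp add: I_def g_def)
  then show ?thesis by (auto simp: X_def)
qed

text \<open>Walk from the overlap with \<open>q\<close> to a generic \<open>p\<close> in the
  relative interior of \<open>q' \<inter> S\<close>. The cell reached there shares \<open>p\<close>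
  with \<open>q'\<close>, so by genericity it is \<open>q'\<close>.\<close>

lemma overlap_same_weight:
  assumes S: "S \<in> max_cells P" and q: "q \<in> max_cells Q" "overlap q S" and q': "q' \<in> max_cells Q" "overlap q' S"
  shows "u q = u q'"
proof -
  note cS = P.cell(2)[OF P.max_cell(1)[OF S]]
  have c: "convex (q' \<inter> S)" using cells(2)[OF q'(1)] cS by (rule convex_Int)
  have hull: "affine hull (rel_interior (q' \<inter> S)) = affine hull (q' \<inter> S)"
    by (rule rel_interior_same_affine_hull[OF c])
  then have dim: "aff_dim (rel_interior (q' \<inter> S)) = complex_dim P"
    using q'(2) aff_dim_affine_hull unfolding overlap_def by metis
  obtain p where p: "p \<in> rel_interior (q' \<inter> S)" and low: "\<And>B. B \<in> Q \<Longrightarrow> aff_dim B < complex_dim P \<Longrightarrow> p \<notin> B"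
    using generic_point[OF convex_rel_interior[OF c] dim] by blast
  have pqS: "p \<in> q'" "p \<in> S" using p rel_interior_subset by blast+
  have "affine hull (q' \<inter> S) = affine hull S"
    using q'(2) P.max_cell(2)[OF S] pqS unfolding overlap_def
    by (intro affine_dim_equal) (auto intro: hull_mono[THEN subsetD])
  then have "p \<in> rel_interior S" using p subset_rel_interior[of "q' \<inter> S" S] by auto
  then obtain r where r: "r \<in> max_cells Q" "p \<in> r" "u r = u q"
    using weight_at_generic_point[OF S q _ low] by blast
  have "q' \<inter> r \<in> Q"
    using Q.face_cell[OF cells(1)[OF q'(1)] Q.Int_face(1)[OF cells(1)[OF q'(1)] cells(1)[OF r(1)]]] pqS r(2) by blast
  then have "complex_dim Q \<le> aff_dim (q' \<inter> r)" using low[of "q' \<inter> r"] pqS r(2) dim_eq by force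
  then show ?thesis using Q.max_cells_eqI[OF q'(1) r(1)] r(3) by simp
qed

text \<open>A missed point of \<open>S\<close> would have a missed neighbourhood, since the union of
  \<open>Q\<close> is closed; but that neighbourhood contains a generic relative interior point of
  \<open>S\<close>, which \<open>weight_at_generic_point\<close> reaches.\<close>

lemma overlap_imp_subset:
  assumes S: "S \<in> max_cells P" and q: "q \<in> max_cells Q" "overlap q S"
  shows "S \<subseteq> \<Union>Q"
proof
  fix y assume y: "y \<in> S"
  note cS = P.cell(2)[OF P.max_cell(1)[OF S]]
  show "y \<in> \<Union>Q"
  proof (rule ccontr)
    assume "y \<notin> \<Union>Q"
    moreover have "closed (\<Union>Q)" using Q.finite_cells Q.cell(3) by (intro closed_Union) auto
    ultimately obtain e where e: "e > 0" "ball y e \<subseteq> - \<Union>Q"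
      using openE[of "- \<Union>Q" y] by (auto simp: open_Compl)
    define U where "U = rel_interior S \<inter> ball y e"
    have "y \<in> closure (rel_interior S)"
      using convex_closure_rel_interior[OF cS] y closure_subset by blast
    then have ne: "U \<noteq> {}"
    proof -
      have "y \<in> ball y e \<inter> closure (rel_interior S)" using \<open>y \<in> closure _\<close> e(1) by simp
      then show ?thesis
        using open_Int_closure_eq_empty[OF open_ball, of y e "rel_interior S"] unfolding U_def by blast
    qed
    have cU: "convex U" unfolding U_def using convex_rel_interior[OF cS] by (intro convex_Int convex_ball)
    have "aff_dim U = aff_dim (rel_interior S)"
      using ne unfolding U_def by (intro aff_dim_convex_Int_open convex_rel_interior[OF cS]) auto
    then have dU: "aff_dim U = complex_dim P"
      using rel_interior_same_affine_hull[OF cS] aff_dim_affine_hull P.max_cell(2)[OF S] by metis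
    obtain p where p: "p \<in> U" and low: "\<And>B. B \<in> Q \<Longrightarrow> aff_dim B < complex_dim P \<Longrightarrow> p \<notin> B"
      using generic_point[OF cU dU] by blast
    then obtain r where "r \<in> max_cells Q" "p \<in> r"
      using weight_at_generic_point[OF S q _ low] unfolding U_def by blast
    then show False using p e(2) cells(1) unfolding U_def by blast
  qed
qed

text \<open>The choice of \<open>q\<close> is harmless by \<open>overlap_same_weight\<close>. A
  maximal cell of \<open>P\<close> that no cell of \<open>Q\<close> overlaps gets weight 0.\<close>

definition pushed :: "(real^'d) set \<Rightarrow> real" where
  "pushed S = (if S \<in> max_cells P \<and> (\<exists>q\<in>max_cells Q. overlap q S)
    then u (SOME q. q \<in> max_cells Q \<and> overlap q S) else 0)"

lemma pushed_eq:
  assumes "S \<in> max_cells P" "q \<in> max_cells Q" "overlap q S"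
  shows "pushed S = u q"
proof -
  define r where "r = (SOME q. q \<in> max_cells Q \<and> overlap q S)"
  have r: "r \<in> max_cells Q" "overlap r S"
    unfolding r_def using someI[of "\<lambda>q. q \<in> max_cells Q \<and> overlap q S" q] assms by auto
  then have "pushed S = u r" using assms unfolding pushed_def r_def by auto
  then show ?thesis using overlap_same_weight[OF assms(1) r assms(2,3)] by simp
qed

lemma pushed_nonzero:
  assumes "pushed S \<noteq> 0"
  obtains q where "S \<in> max_cells P" "q \<in> max_cells Q" "overlap q S" "pushed S = u q"
proof -
  from assms obtain q where q: "S \<in> max_cells P" "q \<in> max_cells Q" "overlap q S"
    unfolding pushed_def by (auto split: if_splits)
  show thesis using that[OF q pushed_eq[OF q]] .
qed

lemma pushed_nonneg: "0 \<le> pushed S"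
  using pushed_nonzero u_pos by (metis less_eq_real_def order_refl)

text \<open>One inclusion is \<open>overlap_imp_subset\<close>. For the other, a point of
  \<open>q\<close> outside the closed support has a neighbourhood missing it; there \<open>q\<close>
  still has full dimension and is covered by cells of \<open>P\<close>, so it overlaps one of them,
  whose weight is positive.\<close>

lemma support_variety_pushed: "support_variety P pushed = \<Union>Q"
proof
  show "support_variety P pushed \<subseteq> \<Union>Q"
  proof
    fix y assume "y \<in> support_variety P pushed"
    then obtain S where S: "0 < pushed S" "y \<in> S" unfolding support_variety_def by blast
    then obtain q where "S \<in> max_cells P" "q \<in> max_cells Q" "overlap q S"
      using pushed_nonzero[of S] S(1) by (metis less_irrefl)
    then show "y \<in> \<Union>Q" using overlap_imp_subset S(2) by blast
  qed
  show "\<Union>Q \<subseteq> support_variety P pushed"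
  proof
    fix y assume "y \<in> \<Union>Q"
    then obtain q where q: "q \<in> max_cells Q" "y \<in> q" using Q.Union_max_cells by blast
    show "y \<in> support_variety P pushed"
    proof (rule ccontr)
      assume "y \<notin> support_variety P pushed"
      moreover have "closed (support_variety P pushed)"
        unfolding support_variety_def using P.finite_max_cells P.cell(3) P.max_cell(1)
        by (intro closed_Union) auto
      ultimately obtain e where e: "e > 0" "ball y e \<subseteq> - support_variety P pushed"
        using openE[of "- support_variety P pushed" y] by (auto simp: open_Compl)
      define U where "U = q \<inter> ball y e"
      have yU: "y \<in> U" using q e by (simp add: U_def)
      have "aff_dim U = aff_dim q"
        using yU unfolding U_def by (intro aff_dim_convex_Int_open cells(2)[OF q(1)]) auto
      then have dU: "aff_dim U = complex_dim P" using cells(5)[OF q(1)] by simp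
      have cU: "convex U" unfolding U_def using cells(2)[OF q(1)] by (intro convex_Int convex_ball)
      have "U \<subseteq> \<Union>(max_cells P)" using cells(6)[OF q(1)] P.Union_max_cells unfolding U_def by auto
      then obtain S where S: "S \<in> max_cells P" "aff_dim (S \<inter> U) = aff_dim U"
        using convex_cover_full_dim[OF P.finite_max_cells cU] yU by blast
      have "convex (S \<inter> U)" using P.cell(2)[OF P.max_cell(1)[OF S(1)]] cU by (rule convex_Int)
      then obtain x where x: "x \<in> S \<inter> U" using generic_point S(2) dU by metis
      have "aff_dim (S \<inter> U) \<le> aff_dim (q \<inter> S)" by (rule aff_dim_subset) (auto simp: U_def)
      moreover have "aff_dim (q \<inter> S) \<le> aff_dim q" by (rule aff_dim_subset) simp
      ultimately have "overlap q S" using S(2) dU cells(5)[OF q(1)] by (simp add: overlap_def)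
      then have "0 < pushed S" using pushed_eq[OF S(1) q(1)] u_pos[OF q(1)] by simp
      then have "x \<in> support_variety P pushed" using x S(1) by (auto simp: support_variety_def)
      then show False using x e(2) unfolding U_def by blast
    qed
  qed
qed

text \<open>Let \<open>F\<close> be the cell of \<open>Q\<close> with a generic point
  \<open>x\<close> of \<open>T\<close> in its relative interior. If \<open>F\<close> is maximal and
  some cell at \<open>T\<close> has weight, then exactly two have, with equal weights and opposite
  normals. If \<open>F\<close> is a ridge, it is parallel to \<open>T\<close>, and its maximal cells
  match the weighted cells at \<open>T\<close> in weight and normal.\<close>

lemma pushed_balanced_at:
  assumes T: "T \<in> ridges P"
  shows "(\<Sum>S | S \<in> max_cells P \<and> T face_of S. pushed S *\<^sub>R ridge_normal T S) \<in> parallel_space T"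
proof -
  note TP = P.ridge(1)[OF T]
  note sT = subspace_parallel_space[OF P.cell(4)[OF TP]]
  \<comment> \<open>Avoiding the traces of smaller dimension on \<open>T\<close> forces every cell
    of \<open>Q\<close> through \<open>x\<close> to contain all directions of
    \<open>T\<close>.\<close>
  define \<A> where "\<A> = (\<lambda>B. B \<inter> T) ` Q \<inter> {A. aff_dim A < aff_dim T}"
  have hullT: "aff_dim (rel_interior T) = aff_dim T"
    using rel_interior_same_affine_hull[OF P.cell(2)[OF TP]] aff_dim_affine_hull by metis
  have "rel_interior T \<noteq> {}" using rel_interior_eq_empty[OF P.cell(2)[OF TP]] P.cell(4)[OF TP] by simp
  moreover have "finite \<A>" using Q.finite_cells by (simp add: \<A>_def)
  moreover have "aff_dim A < aff_dim (rel_interior T)" if "A \<in> \<A>" for A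
    using that hullT by (simp add: \<A>_def)
  ultimately obtain x where x: "x \<in> rel_interior T" and avoid: "\<And>A. A \<in> \<A> \<Longrightarrow> x \<notin> A"
    using convex_avoid_low_dim[OF _ convex_rel_interior[OF P.cell(2)[OF TP]]] by blast
  have xT: "x \<in> T" using x rel_interior_subset by blast
  have TB: "parallel_space T \<subseteq> parallel_space B" if B: "B \<in> Q" "x \<in> B" for B
  proof -
    have "B \<inter> T \<notin> \<A>" using avoid B(2) xT by blast
    then have "aff_dim T \<le> aff_dim (B \<inter> T)" using B(1) by (auto simp: \<A>_def)
    then have "parallel_space (B \<inter> T) = parallel_space T"
      using B(2) xT by (intro parallel_space_eqI parallel_space_mono) auto
    then show ?thesis using parallel_space_mono[of "B \<inter> T" B] by simp
  qed
  define A where "A = {S. S \<in> max_cells P \<and> T face_of S \<and> pushed S \<noteq> 0}"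
  define \<zeta> where "\<zeta> = ridge_normal T"
  have "finite {S. S \<in> max_cells P \<and> T face_of S}" using P.finite_max_cells by simp
  then have sumA: "(\<Sum>S | S \<in> max_cells P \<and> T face_of S. pushed S *\<^sub>R ridge_normal T S) = (\<Sum>S\<in>A. pushed S *\<^sub>R \<zeta> S)"
    unfolding A_def \<zeta>_def by (intro sum.mono_neutral_right) auto
  have normals: "is_ridge_normal T S (\<zeta> S)" "\<zeta> S \<notin> parallel_space T" "\<zeta> S \<in> radial_cone S x"
      "parallel_space T \<subseteq> radial_cone S x" "x \<in> S"
      "parallel_space S = {l + s *\<^sub>R \<zeta> S | l s. l \<in> parallel_space T}"
      "radial_cone S x = {l + s *\<^sub>R \<zeta> S | l s. l \<in> parallel_space T \<and> 0 \<le> s}"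
    if S: "S \<in> max_cells P" "T face_of S" for S
  proof -
    show 1: "is_ridge_normal T S (\<zeta> S)" unfolding \<zeta>_def using P.ridge_normal[OF T S] .
    show "\<zeta> S \<notin> parallel_space T" using P.ridge_normal_notin[OF T S 1] .
    show "\<zeta> S \<in> radial_cone S x" using P.normal_radial[OF T S 1 x] .
    show "parallel_space T \<subseteq> radial_cone S x" using P.ridge_directions[OF T S 1 x] .
    show "x \<in> S" using xT S(2) face_of_imp_subset by blast
    show "parallel_space S = {l + s *\<^sub>R \<zeta> S | l s. l \<in> parallel_space T}"
      using P.parallel_space_max_cell[OF T S 1] .
    show "radial_cone S x = {l + s *\<^sub>R \<zeta> S | l s. l \<in> parallel_space T \<and> 0 \<le> s}"
      using P.radial_cone_half_space[OF T S 1 x] .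
  qed
  have AD: "S \<in> max_cells P" "T face_of S" "S \<subseteq> \<Union>Q" if S: "S \<in> A" for S
  proof -
    show "S \<in> max_cells P" "T face_of S" using S by (auto simp: A_def)
    obtain q where "q \<in> max_cells Q" "overlap q S"
      using S pushed_nonzero[of S] unfolding A_def by blast
    then show "S \<subseteq> \<Union>Q" using overlap_imp_subset \<open>S \<in> max_cells P\<close> by blast
  qed
  have uniq: "S = S'"
    if S: "S \<in> max_cells P" "T face_of S" and S': "S' \<in> max_cells P" "T face_of S'"
      and d: "\<zeta> S - \<zeta> S' \<in> parallel_space T" for S S'
  proof (rule P.unique_max_cell_direction[OF T x S(1) S'(1) normals(5)[OF S] normals(5)[OF S'] normals(3)[OF S] _ normals(2)[OF S]])
    show "\<zeta> S \<in> radial_cone S' x" unfolding normals(7)[OF S']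
      using d by (intro CollectI exI[of _ "\<zeta> S - \<zeta> S'"] exI[of _ 1]) simp
  qed
  show ?thesis
  proof (cases "A = {}")
    case True
    then show ?thesis using sumA subspace_0[OF sT] by simp
  next
    case False
    then obtain S1 where S1: "S1 \<in> A" by blast
    note S1m = AD(1,2)[OF S1]
    have "x \<in> \<Union>Q" using normals(5)[OF S1m] AD(3)[OF S1] by blast
    then obtain F where F: "F \<in> Q" "x \<in> rel_interior F" by (rule Q.rel_interior_cell)
    have xF: "x \<in> F" using F(2) rel_interior_subset by blast
    note TF = TB[OF F(1) xF]
    have "dim (parallel_space T) \<le> dim (parallel_space F)" using TF by (rule dim_subset)
    then have "aff_dim T \<le> aff_dim F"
      using dim_parallel_space[OF P.cell(4)[OF TP]] dim_parallel_space[OF Q.cell(4)[OF F(1)]] by linarith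
    then consider "aff_dim F = complex_dim P" | "aff_dim F = complex_dim P - 1"
      using Q.cell_dim_le[OF F(1)] dim_eq P.ridge(2)[OF T] by linarith
    then show ?thesis
    proof cases
      case 1
      then have Fm: "F \<in> max_cells Q" using F(1) dim_eq by (simp add: max_cells_def)
      note sF = subspace_parallel_space[OF Q.cell(4)[OF F(1)]]
      have rcF: "radial_cone F x = parallel_space F" using radial_cone_rel_interior[OF F(2)] .
      \<comment> \<open>\<open>F\<close> is the only cell of \<open>Q\<close> through
        \<open>x\<close>, and weighted cells lie in the union of \<open>Q\<close>, so their normals
        are directions of \<open>F\<close>.\<close>
      have toF: "\<zeta> S \<in> parallel_space F" if S: "S \<in> A" for S
      proof -
        note Sm = AD(1,2)[OF S]
        obtain q where q: "q \<in> max_cells Q" "x \<in> q" "\<zeta> S \<in> radial_cone q x"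
          using Q.ray_in_max_cell[OF P.cell(2)[OF P.max_cell(1)[OF Sm(1)]] AD(3)[OF S] normals(5)[OF Sm] normals(3)[OF Sm]] .
        have "q = F" using Q.rel_interior_max_cell_unique[OF Fm cells(1)[OF q(1)] F(2) q(2)] .
        then show ?thesis using q(3) rcF by simp
      qed
      have ov: "overlap F S"
        if S: "S \<in> max_cells P" "T face_of S" and v: "v \<in> radial_cone S x" "v \<in> parallel_space F" "v \<notin> parallel_space T" for S v
        by (rule overlapI[OF Fm S(1) xF normals(5)[OF S] P.cell(4)[OF TP] P.ridge(2)[OF T] _ normals(4)[OF S] _ v(1) v(3)])
          (use TF v rcF in auto)
      have pF: "parallel_space S = parallel_space F"
        if S: "S \<in> max_cells P" "T face_of S" and z: "\<zeta> S \<in> parallel_space F" for S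
      proof (rule parallel_space_eqI)
        show "parallel_space S \<subseteq> parallel_space F"
          unfolding normals(6)[OF S] using z TF subspace_add[OF sF] subspace_scale[OF sF] by fastforce
      qed (use S P.cell(4) P.max_cell Q.cell(4) F(1) 1 in auto)
      \<comment> \<open>\<open>F\<close> continues across \<open>T\<close>, so it also contains the
        direction opposite to the normal of \<open>S1\<close>; the cell of \<open>P\<close> carrying
        that direction is the second weighted cell.\<close>
      have z1F: "- \<zeta> S1 \<in> radial_cone F x" using toF[OF S1] rcF subspace_neg[OF sF] by simp
      obtain S2 where S2: "S2 \<in> max_cells P" "x \<in> S2" "- \<zeta> S1 \<in> radial_cone S2 x"
        using P.ray_in_max_cell[OF cells(2)[OF Fm] cells(6)[OF Fm] xF z1F] .
      have TS2: "T face_of S2" using P.face_if_rel_interior[OF TP P.max_cell(1)[OF S2(1)] x S2(2)] .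
      note S2m = S2(1) TS2
      have nz1: "- \<zeta> S1 \<notin> parallel_space T"
        using normals(2)[OF S1m] subspace_neg[OF sT, of "- \<zeta> S1"] by auto
      have ov2: "overlap F S2" using ov[OF S2m S2(3) _ nz1] z1F rcF by simp
      have S2A: "S2 \<in> A" using pushed_eq[OF S2(1) Fm ov2] u_pos[OF Fm] S2m by (simp add: A_def)
      have p12: "parallel_space S = parallel_space S1" if "S \<in> A" for S
        using pF[OF AD(1,2)[OF that] toF[OF that]] pF[OF S1m toF[OF S1]] by simp
      have "is_ridge_normal T S2 (- \<zeta> S1)"
        by (rule is_ridge_normal_uminusI[OF normals(1)[OF S1m] refl p12[OF S2A] xT S2(3) P.cell(4)[OF P.max_cell(1)[OF S1m(1)]]])
      then have z2: "\<zeta> S2 + \<zeta> S1 \<in> parallel_space T"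
        using P.ridge_normal_unique[OF T S2m _ normals(1)[OF S2m], of "- \<zeta> S1"] by simp
      have "S1 \<noteq> S2"
      proof
        assume "S1 = S2"
        then show False
          using P.minus_normal_notin[OF T S1m normals(1)[OF S1m] x, of "- \<zeta> S1"] S2(3) subspace_0[OF sT] by simp
      qed
      moreover have "A = {S1, S2}"
      proof -
        have "S = S1 \<or> S = S2" if S: "S \<in> A" for S
        proof -
          note Sm = AD(1,2)[OF S]
          have "\<zeta> S - \<zeta> S1 \<in> parallel_space T \<or> \<zeta> S + \<zeta> S1 \<in> parallel_space T"
            using ridge_normals_same_or_opposite[OF normals(1)[OF S1m] normals(1)[OF Sm] refl p12[OF S] P.cell(4)[OF TP] normals(2)[OF S1m]] .
          then show ?thesis
          proof
            assume "\<zeta> S - \<zeta> S1 \<in> parallel_space T"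
            then show ?thesis using uniq[OF Sm S1m] by simp
          next
            assume "\<zeta> S + \<zeta> S1 \<in> parallel_space T"
            then have "\<zeta> S - \<zeta> S2 \<in> parallel_space T" using subspace_diff[OF sT _ z2] by fastforce
            then show ?thesis using uniq[OF Sm S2m] by simp
          qed
        qed
        then show ?thesis using S1 S2A by blast
      qed
      ultimately have "(\<Sum>S\<in>A. pushed S *\<^sub>R \<zeta> S) = pushed S1 *\<^sub>R \<zeta> S1 + pushed S2 *\<^sub>R \<zeta> S2" by simp
      also have "pushed S1 = u F"
        using pushed_eq[OF S1m(1) Fm ov[OF S1m normals(3)[OF S1m] toF[OF S1] normals(2)[OF S1m]]] .
      also have "pushed S2 = u F" using pushed_eq[OF S2(1) Fm ov2] .
      also have "u F *\<^sub>R \<zeta> S1 + u F *\<^sub>R \<zeta> S2 = u F *\<^sub>R (\<zeta> S2 + \<zeta> S1)" by (simp add: scaleR_add_right)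
      finally show ?thesis using sumA subspace_scale[OF sT z2] by simp
    next
      case 2
      then have Fr: "F \<in> ridges Q" using F(1) dim_eq by (simp add: ridges_def)
      have FT: "parallel_space F = parallel_space T"
        using parallel_space_eqI[OF P.cell(4)[OF TP] Q.cell(4)[OF F(1)] TF] 2 P.ridge(2)[OF T] by simp
      define A' where "A' = {q. q \<in> max_cells Q \<and> F face_of q}"
      have A'D: "q \<in> max_cells Q" "F face_of q" if "q \<in> A'" for q using that by (auto simp: A'_def)
      define \<eta> where "\<eta> = ridge_normal F"
      have \<eta>: "is_ridge_normal F q (\<eta> q)" "\<eta> q \<notin> parallel_space F" "\<eta> q \<in> radial_cone q x"
        "parallel_space F \<subseteq> radial_cone q x" "x \<in> q"
        "parallel_space q = {l + s *\<^sub>R \<eta> q | l s. l \<in> parallel_space F}"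
        if q: "q \<in> A'" for q
      proof -
        note q' = A'D[OF q]
        show 1: "is_ridge_normal F q (\<eta> q)" unfolding \<eta>_def using Q.ridge_normal[OF Fr q'] .
        show "\<eta> q \<notin> parallel_space F" using Q.ridge_normal_notin[OF Fr q' 1] .
        show "\<eta> q \<in> radial_cone q x" using Q.normal_radial[OF Fr q' 1 F(2)] .
        show "parallel_space F \<subseteq> radial_cone q x" using Q.ridge_directions[OF Fr q' 1 F(2)] .
        show "x \<in> q" using xF q'(2) face_of_imp_subset by blast
        show "parallel_space q = {l + s *\<^sub>R \<eta> q | l s. l \<in> parallel_space F}"
          using Q.parallel_space_max_cell[OF Fr q' 1] .
      qed
      \<comment> \<open>The correspondence sends a cell of \<open>Q\<close> at \<open>F\<close> to
        the cell of \<open>P\<close> that contains its normal direction at \<open>x\<close>.\<close>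
      have "\<exists>S. S \<in> max_cells P \<and> x \<in> S \<and> \<eta> q \<in> radial_cone S x" if q: "q \<in> A'" for q
        using P.ray_in_max_cell[OF cells(2)[OF A'D(1)[OF q]] cells(6)[OF A'D(1)[OF q]] \<eta>(5)[OF q] \<eta>(3)[OF q]] by blast
      then obtain f where f: "\<And>q. q \<in> A' \<Longrightarrow> f q \<in> max_cells P" "\<And>q. q \<in> A' \<Longrightarrow> x \<in> f q"
        "\<And>q. q \<in> A' \<Longrightarrow> \<eta> q \<in> radial_cone (f q) x" by metis
      have fT: "T face_of f q" if q: "q \<in> A'" for q
        using P.face_if_rel_interior[OF TP P.max_cell(1)[OF f(1)[OF q]] x f(2)[OF q]] .
      have nT: "\<eta> q \<notin> parallel_space T" if "q \<in> A'" for q using \<eta>(2)[OF that] FT by simp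
      have fpush: "pushed (f q) = u q" if q: "q \<in> A'" for q
      proof -
        have "overlap q (f q)"
          by (rule overlapI[OF A'D(1)[OF q] f(1)[OF q] \<eta>(5)[OF q] f(2)[OF q] P.cell(4)[OF TP] P.ridge(2)[OF T]
                _ normals(4)[OF f(1)[OF q] fT[OF q]] \<eta>(3)[OF q] f(3)[OF q] nT[OF q]])
            (use \<eta>(4)[OF q] FT in simp)
        then show ?thesis using pushed_eq[OF f(1)[OF q] A'D(1)[OF q]] by simp
      qed
      have fnormal: "is_ridge_normal T (f q) (\<eta> q)" if q: "q \<in> A'" for q
      proof (rule is_ridge_normalI[OF \<eta>(1)[OF q] FT[symmetric] _ xT f(3)[OF q]])
        have f0: "f q \<noteq> {}" using f(2)[OF q] by blast
        note sf = subspace_parallel_space[OF f0]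
        have "parallel_space F \<subseteq> parallel_space (f q)" "\<eta> q \<in> parallel_space (f q)"
          using FT normals(4)[OF f(1)[OF q] fT[OF q]] f(3)[OF q] radial_cone_subset_parallel_space[OF f(2)[OF q]] by auto
        then have "parallel_space q \<subseteq> parallel_space (f q)"
          unfolding \<eta>(6)[OF q] using subspace_add[OF sf] subspace_scale[OF sf] by fastforce
        then have "parallel_space q = parallel_space (f q)"
          using parallel_space_eqI[OF cells(4)[OF A'D(1)[OF q]] f0] cells(5)[OF A'D(1)[OF q]] P.max_cell(2)[OF f(1)[OF q]] by simp
        then show "parallel_space (f q) = parallel_space q" by simp
      qed
      have diff: "\<zeta> (f q) - \<eta> q \<in> parallel_space T" if q: "q \<in> A'" for q
        using P.ridge_normal_unique[OF T f(1)[OF q] fT[OF q] fnormal[OF q] normals(1)[OF f(1)[OF q] fT[OF q]]] .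
      have inj: "inj_on f A'"
      proof
        fix q r assume q: "q \<in> A'" and r: "r \<in> A'" and eq: "f q = f r"
        show "q = r"
        proof (rule Q.unique_max_cell_direction[OF Fr F(2) A'D(1)[OF q] A'D(1)[OF r] \<eta>(5)[OF q] \<eta>(5)[OF r] \<eta>(3)[OF q] _ \<eta>(2)[OF q]])
          have "\<eta> q - \<eta> r \<in> parallel_space F"
            unfolding FT
            using subspace_diff[OF sT diff[OF r] diff[OF q]] eq by simp
          then have "(\<eta> q - \<eta> r) + \<eta> r \<in> radial_cone r x"
            using \<eta>(4)[OF r] \<eta>(3)[OF r] by (intro radial_cone_add[OF cells(2)[OF A'D(1)[OF r]] \<eta>(5)[OF r]]) auto
          then show "\<eta> q \<in> radial_cone r x" by simp
        qed
      qed
      have "f ` A' = A"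
      proof (intro equalityI subsetI)
        fix S assume "S \<in> f ` A'"
        then obtain q where q: "q \<in> A'" "S = f q" by blast
        then show "S \<in> A" using f(1)[OF q(1)] fT[OF q(1)] fpush[OF q(1)] u_pos[OF A'D(1)[OF q(1)]] by (simp add: A_def)
      next
        \<comment> \<open>The normal of a weighted cell enters some maximal cell \<open>q\<close> of
          \<open>Q\<close>. Modulo \<open>T\<close> it is a positive multiple of the normal of
          \<open>q\<close>, so the weighted cell is \<open>f q\<close>.\<close>
        fix S assume S: "S \<in> A"
        note Sm = AD(1,2)[OF S]
        obtain q where q: "q \<in> max_cells Q" "x \<in> q" "\<zeta> S \<in> radial_cone q x"
          using Q.ray_in_max_cell[OF P.cell(2)[OF P.max_cell(1)[OF Sm(1)]] AD(3)[OF S] normals(5)[OF Sm] normals(3)[OF Sm]] .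
        have Fq: "F face_of q" using Q.face_if_rel_interior[OF F(1) cells(1)[OF q(1)] F(2) q(2)] .
        then have qA: "q \<in> A'" using q(1) by (simp add: A'_def)
        have "\<zeta> S \<notin> parallel_space F" using normals(2)[OF Sm] FT by simp
        then obtain s where s: "s > 0" "\<zeta> S - s *\<^sub>R \<eta> q \<in> parallel_space F"
          using Q.transverse_direction[OF Fr q(1) Fq \<eta>(1)[OF qA] F(2) q(3)] by blast
        note fq = f(1)[OF qA] fT[OF qA]
        note cf = P.cell(2)[OF P.max_cell(1)[OF fq(1)]]
        have "(\<zeta> S - s *\<^sub>R \<eta> q) + s *\<^sub>R \<eta> q \<in> radial_cone (f q) x"
        proof (rule radial_cone_add[OF cf f(2)[OF qA]])
          show "\<zeta> S - s *\<^sub>R \<eta> q \<in> radial_cone (f q) x" using s(2) FT normals(4)[OF fq] by blast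
          show "s *\<^sub>R \<eta> q \<in> radial_cone (f q) x"
            using radial_cone_scale[OF cf f(2)[OF qA] f(3)[OF qA]] s(1) by simp
        qed
        then have "\<zeta> S \<in> radial_cone (f q) x" by simp
        then have "S = f q"
          using P.unique_max_cell_direction[OF T x Sm(1) fq(1) normals(5)[OF Sm] f(2)[OF qA] normals(3)[OF Sm] _ normals(2)[OF Sm]] by simp
        then show "S \<in> f ` A'" using qA by blast
      qed
      then have "(\<Sum>S\<in>A. pushed S *\<^sub>R \<zeta> S) = (\<Sum>q\<in>A'. pushed (f q) *\<^sub>R \<zeta> (f q))"
        using sum.reindex[OF inj, of "\<lambda>S. pushed S *\<^sub>R \<zeta> S"] by simp
      \<comment> \<open>Corresponding normals differ by directions of \<open>T\<close>, so the
        balancing of \<open>u\<close> at \<open>F\<close> is all that remains.\<close>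
      also have "\<dots> = (\<Sum>q\<in>A'. u q *\<^sub>R \<eta> q + u q *\<^sub>R (\<zeta> (f q) - \<eta> q))"
        by (rule sum.cong) (simp_all add: fpush scaleR_diff_right)
      also have "\<dots> = (\<Sum>q\<in>A'. u q *\<^sub>R \<eta> q) + (\<Sum>q\<in>A'. u q *\<^sub>R (\<zeta> (f q) - \<eta> q))"
        by (rule sum.distrib)
      also have "\<dots> \<in> parallel_space T"
      proof (rule subspace_add[OF sT])
        have "(\<Sum>q\<in>A'. u q *\<^sub>R \<eta> q) \<in> parallel_space F"
          using bal Fr unfolding balanced_maps_def A'_def \<eta>_def by blast
        then show "(\<Sum>q\<in>A'. u q *\<^sub>R \<eta> q) \<in> parallel_space T" using FT by simp
        show "(\<Sum>q\<in>A'. u q *\<^sub>R (\<zeta> (f q) - \<eta> q)) \<in> parallel_space T"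
          using diff by (intro subspace_sum[OF sT] subspace_scale[OF sT]) auto
      qed
      finally show ?thesis using sumA by simp
    qed
  qed
qed

lemma pushed_in_balanced_maps: "pushed \<in> balanced_maps P"
proof -
  have "pushed S = 0" if "S \<notin> max_cells P" for S using that by (simp add: pushed_def)
  then show ?thesis
    unfolding balanced_maps_def using pushed_nonneg pushed_balanced_at by blast
qed

end

subsection \<open>The cone of balanced maps\<close>

lemma scaleR_fun_apply [simp]: "(r *\<^sub>R f) x = r *\<^sub>R f x"
  by (simp add: scaleR_fun_def)

lemma sum_fun_apply: "(\<Sum>a\<in>A. f a) x = (\<Sum>a\<in>A. f a x)"
  by (induction A rule: infinite_finite_induct) simp_all

definition supp :: "('i \<Rightarrow> real) \<Rightarrow> 'i set" where
  "supp w = {S. w S \<noteq> 0}"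

lemma supp_empty_iff: "supp w = {} \<longleftrightarrow> w = 0"
  by (auto simp: supp_def fun_eq_iff)

context pure_rational_complex
begin

lemma balanced_mapsD:
  assumes "w \<in> balanced_maps P"
  shows "0 \<le> w S" "S \<notin> max_cells P \<Longrightarrow> w S = 0"
    "T \<in> ridges P \<Longrightarrow> (\<Sum>S | S \<in> max_cells P \<and> T face_of S. w S *\<^sub>R ridge_normal T S) \<in> parallel_space T"
proof -
  show 1: "w S = 0" if "S \<notin> max_cells P" using that assms unfolding balanced_maps_def by blast
  show "0 \<le> w S" using assms 1 unfolding balanced_maps_def by (cases "S \<in> max_cells P") auto
  show "T \<in> ridges P \<Longrightarrow> (\<Sum>S | S \<in> max_cells P \<and> T face_of S. w S *\<^sub>R ridge_normal T S) \<in> parallel_space T"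
    using assms unfolding balanced_maps_def by blast
qed

lemma balanced_maps_combine:
  assumes v: "v \<in> balanced_maps P" and w: "w \<in> balanced_maps P" and nonneg: "\<And>S. 0 \<le> a * v S + b * w S"
  shows "a *\<^sub>R v + b *\<^sub>R w \<in> balanced_maps P"
  unfolding balanced_maps_def
proof (intro CollectI conjI ballI allI impI)
  fix T assume T: "T \<in> ridges P"
  have sT: "subspace (parallel_space T)" using subspace_parallel_space[OF cell(4)[OF ridge(1)[OF T]]] .
  have "a *\<^sub>R (\<Sum>S | S \<in> max_cells P \<and> T face_of S. v S *\<^sub>R ridge_normal T S) +
    b *\<^sub>R (\<Sum>S | S \<in> max_cells P \<and> T face_of S. w S *\<^sub>R ridge_normal T S) \<in> parallel_space T"
    using balanced_mapsD(3)[OF v T] balanced_mapsD(3)[OF w T]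
    by (intro subspace_add[OF sT] subspace_scale[OF sT])
  then show "(\<Sum>S | S \<in> max_cells P \<and> T face_of S. (a *\<^sub>R v + b *\<^sub>R w) S *\<^sub>R ridge_normal T S) \<in> parallel_space T"
    by (simp add: scaleR_add_left sum.distrib scaleR_sum_right)
qed (use nonneg balanced_mapsD(2)[OF v] balanced_mapsD(2)[OF w] in auto)

lemma zero_balanced: "0 \<in> balanced_maps P"
proof -
  have "0 \<in> parallel_space T" if "T \<in> ridges P" for T
    using subspace_0[OF subspace_parallel_space[OF cell(4)[OF ridge(1)[OF that]]]] .
  then show ?thesis by (auto simp: balanced_maps_def)
qed

lemma convex_cone_balanced_maps: "convex_cone (balanced_maps P)"
proof -
  have "v + w \<in> balanced_maps P" if "v \<in> balanced_maps P" "w \<in> balanced_maps P" for v w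
    using balanced_maps_combine[OF that, of 1 1] balanced_mapsD(1)[OF that(1)] balanced_mapsD(1)[OF that(2)] by simp
  moreover have "c *\<^sub>R v \<in> balanced_maps P" if "v \<in> balanced_maps P" "0 \<le> c" for c v
    using balanced_maps_combine[OF that(1) that(1), of c 0] balanced_mapsD(1)[OF that(1)] that(2) by simp
  ultimately show ?thesis using zero_balanced unfolding convex_cone_iff by blast
qed

lemma strongly_convex_cone_balanced_maps: "strongly_convex_cone (balanced_maps P)"
  unfolding strongly_convex_cone_def
proof (intro conjI ballI convex_cone_balanced_maps)
  fix x y assume x: "x \<in> balanced_maps P" and y: "y \<in> balanced_maps P"
  show "x + y = 0 \<longleftrightarrow> x = 0 \<and> y = 0"
  proof
    assume "x + y = 0"
    then have "x S + y S = 0" for S by (metis plus_fun_apply zero_fun_apply)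
    then have "x S = 0 \<and> y S = 0" for S
      using balanced_mapsD(1)[OF x, of S] balanced_mapsD(1)[OF y, of S] by (metis add_nonneg_eq_0_iff)
    then show "x = 0 \<and> y = 0" by (simp add: fun_eq_iff)
  qed simp
qed

lemma supp_subset: "w \<in> balanced_maps P \<Longrightarrow> supp w \<subseteq> max_cells P"
  using balanced_mapsD(2) unfolding supp_def by blast

lemma finite_supp: "w \<in> balanced_maps P \<Longrightarrow> finite (supp w)"
  using supp_subset finite_max_cells finite_subset by blast

text \<open>Membership in the span of a ridge becomes a system of equations with integer
  coefficients once combinations of spanning lattice vectors are added as unknowns. Equality of
  signs then gives both nonnegativity and equality of supports.\<close>

lemma integer_balanced_map:
  assumes v: "v \<in> balanced_maps P"
  shows "\<exists>w\<in>balanced_maps P. supp w = supp v \<and> (\<forall>S. w S \<in> \<int>)"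
proof -
  have "\<exists>B. finite B \<and> B \<subseteq> parallel_lattice T \<and> span B = parallel_space T" if T: "T \<in> ridges P" for T
  proof -
    have "lattice_has_rank (parallel_lattice T) (nat (aff_dim T))"
      using rational T unfolding rational_complex_def by blast
    from parallel_lattice_spans[OF cell(4)[OF ridge(1)[OF T]] this]
    obtain B where "finite B" "B \<subseteq> parallel_lattice T" "span B = parallel_space T" .
    then show ?thesis by blast
  qed
  then obtain B where B: "\<And>T. T \<in> ridges P \<Longrightarrow> finite (B T)"
    "\<And>T. T \<in> ridges P \<Longrightarrow> B T \<subseteq> parallel_lattice T"
    "\<And>T. T \<in> ridges P \<Longrightarrow> span (B T) = parallel_space T" by metis
  have "\<forall>T\<in>ridges P. \<exists>c. (\<Sum>S | S \<in> max_cells P \<and> T face_of S. v S *\<^sub>R ridge_normal T S) = (\<Sum>b\<in>B T. c b *\<^sub>R b)"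
  proof
    fix T assume T: "T \<in> ridges P"
    have "(\<Sum>S | S \<in> max_cells P \<and> T face_of S. v S *\<^sub>R ridge_normal T S) \<in> range (\<lambda>c. \<Sum>b\<in>B T. c b *\<^sub>R b)"
      using balanced_mapsD(3)[OF v T] span_finite[OF B(1)[OF T]] B(3)[OF T] by simp
    then show "\<exists>c. (\<Sum>S | S \<in> max_cells P \<and> T face_of S. v S *\<^sub>R ridge_normal T S) = (\<Sum>b\<in>B T. c b *\<^sub>R b)"
      by (rule rangeE) blast
  qed
  from bchoice[OF this] obtain c where c: "\<forall>T\<in>ridges P.
    (\<Sum>S | S \<in> max_cells P \<and> T face_of S. v S *\<^sub>R ridge_normal T S) = (\<Sum>b\<in>B T. c T b *\<^sub>R b)" ..
  \<comment> \<open>The unknowns are the weights of the maximal cells and, for each ridge, the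
    coefficients of a lattice combination. Row \<open>(T, j)\<close> of \<open>a\<close> is
    coordinate \<open>j\<close> of the balancing sum at \<open>T\<close> minus that
    combination.\<close>
  define I where "I = max_cells P <+> (SIGMA T:ridges P. B T)"
  define a where "a = (\<lambda>(T :: (real^'d) set, j :: 'd). \<lambda>Inl S \<Rightarrow> (if T face_of S then ridge_normal T S $ j else 0)
    | Inr (T', b) \<Rightarrow> (if T' = T then - (b $ j) else 0))"
  have finS: "finite (SIGMA T:ridges P. B T)" using finite_ridges B(1) by (intro finite_SigmaI) auto
  have sumI: "(\<Sum>i\<in>I. a (T, j) i * g i) =
      (\<Sum>S | S \<in> max_cells P \<and> T face_of S. g (Inl S) *\<^sub>R ridge_normal T S) $ j - (\<Sum>b\<in>B T. g (Inr (T, b)) *\<^sub>R b) $ j"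
    if T: "T \<in> ridges P" for T j and g :: "(real^'d) set + (real^'d) set \<times> (real^'d) \<Rightarrow> real"
  proof -
    have "(\<Sum>i\<in>I. a (T, j) i * g i) = (\<Sum>S\<in>max_cells P. a (T, j) (Inl S) * g (Inl S)) +
      (\<Sum>p\<in>(SIGMA T:ridges P. B T). a (T, j) (Inr p) * g (Inr p))"
      unfolding I_def using finS finite_max_cells by (subst sum.Plus) (auto simp: comp_def)
    also have "(\<Sum>S\<in>max_cells P. a (T, j) (Inl S) * g (Inl S)) =
      (\<Sum>S | S \<in> max_cells P \<and> T face_of S. ridge_normal T S $ j * g (Inl S))"
      using finite_max_cells by (intro sum.mono_neutral_cong_right) (auto simp: a_def)
    also have "\<dots> = (\<Sum>S | S \<in> max_cells P \<and> T face_of S. g (Inl S) *\<^sub>R ridge_normal T S) $ j"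
      by (simp add: mult.commute)
    also have "(\<Sum>p\<in>(SIGMA T:ridges P. B T). a (T, j) (Inr p) * g (Inr p)) =
      (\<Sum>T'\<in>ridges P. \<Sum>b\<in>B T'. a (T, j) (Inr (T', b)) * g (Inr (T', b)))"
      using B(1) finite_ridges by (subst sum.Sigma) auto
    also have "\<dots> = (\<Sum>T'\<in>ridges P. if T' = T then (\<Sum>b\<in>B T. - (b $ j) * g (Inr (T, b))) else 0)"
      by (rule sum.cong) (auto simp: a_def)
    also have "\<dots> = - (\<Sum>b\<in>B T. g (Inr (T, b)) *\<^sub>R b) $ j"
      using T finite_ridges by (simp add: sum.delta sum_negf mult.commute)
    finally show ?thesis by simp
  qed
  define g where "g = (\<lambda>Inl S \<Rightarrow> v S | Inr (T, b) \<Rightarrow> c T b)"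
  obtain p where p: "\<And>r. r \<in> ridges P \<times> UNIV \<Longrightarrow> (\<Sum>i\<in>I. a r i * of_int (p i)) = 0"
    and sgn: "\<And>i. i \<in> I \<Longrightarrow> sgn (real_of_int (p i)) = sgn (g i)"
  proof (rule integer_solution_same_signs[of I "ridges P \<times> (UNIV :: 'd set)" a g])
    show "finite I" unfolding I_def using finite_max_cells finS by simp
    show "finite (ridges P \<times> (UNIV :: 'd set))" using finite_ridges by simp
    show "a r i \<in> \<int>" if r: "r \<in> ridges P \<times> UNIV" and i: "i \<in> I" for r i
    proof -
      obtain T j where Tj: "r = (T, j)" "T \<in> ridges P" using r by auto
      from i show ?thesis unfolding I_def
      proof (elim PlusE)
        fix S assume S: "S \<in> max_cells P" "i = Inl S"
        show ?thesis
        proof (cases "T face_of S")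
          case True
          have "ridge_normal T S \<in> parallel_lattice S"
            using ridge_normal[OF Tj(2) S(1) True] unfolding is_ridge_normal_def by blast
          then show ?thesis using True by (simp add: a_def Tj S(2) parallel_lattice_def)
        qed (simp add: a_def Tj S(2))
      next
        fix y assume y: "y \<in> (SIGMA T:ridges P. B T)" "i = Inr y"
        then obtain T' b where Tb: "y = (T', b)" "T' \<in> ridges P" "b \<in> B T'" by auto
        then have "b $ j \<in> \<int>" using B(2)[OF Tb(2)] by (auto simp: parallel_lattice_def)
        then show ?thesis by (simp add: a_def Tj y(2) Tb(1))
      qed
    qed
    show "(\<Sum>i\<in>I. a r i * g i) = 0" if r: "r \<in> ridges P \<times> UNIV" for r
    proof -
      obtain T j where Tj: "r = (T, j)" "T \<in> ridges P" using r by auto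
      show ?thesis unfolding Tj(1) sumI[OF Tj(2)] using c[rule_format, OF Tj(2)] by (simp add: g_def)
    qed
  qed blast
  define w where "w S = (if S \<in> max_cells P then real_of_int (p (Inl S)) else 0)" for S
  have sgnw: "sgn (w S) = sgn (v S)" for S
    using sgn[of "Inl S"] balanced_mapsD(2)[OF v] by (auto simp: w_def I_def g_def)
  show ?thesis
  proof (intro bexI conjI allI)
    show "w S \<in> \<int>" for S by (simp add: w_def)
    show "supp w = supp v" using sgnw sgn_0_0 unfolding supp_def by metis
    have "0 \<le> w S" for S
      using sgnw[of S] balanced_mapsD(1)[OF v, of S] by (metis sgn_less not_less)
    moreover have "(\<Sum>S | S \<in> max_cells P \<and> T face_of S. w S *\<^sub>R ridge_normal T S) \<in> parallel_space T"
      if T: "T \<in> ridges P" for T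
    proof -
      have "(\<Sum>S | S \<in> max_cells P \<and> T face_of S. of_int (p (Inl S)) *\<^sub>R ridge_normal T S) =
        (\<Sum>b\<in>B T. of_int (p (Inr (T, b))) *\<^sub>R b)"
        unfolding vec_eq_iff using p[of "(T, _)"] sumI[OF T, where g = "\<lambda>i. of_int (p i)"] T by auto
      also have "\<dots> \<in> span (B T)" by (intro span_sum span_scale span_base)
      finally show ?thesis using B(3)[OF T] by (simp add: w_def cong: conj_cong)
    qed
    moreover have "w S = 0" if "S \<notin> max_cells P" for S using that by (simp add: w_def)
    ultimately show "w \<in> balanced_maps P" unfolding balanced_maps_def by blast
  qed
qed

section \<open>Extreme rays: balanced maps of minimal support\<close>

definition minimal_support :: "((real^'d) set \<Rightarrow> real) \<Rightarrow> bool" where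
  "minimal_support w \<longleftrightarrow> w \<in> balanced_maps P \<and> w \<noteq> 0 \<and>
     (\<forall>v\<in>balanced_maps P. v \<noteq> 0 \<longrightarrow> supp v \<subseteq> supp w \<longrightarrow> supp v = supp w)"

text \<open>\<open>S\<close> minimizes \<open>v / w\<close> on the support of \<open>w\<close>. The
  inequality is cross-multiplied so that it also covers cells where \<open>w\<close>
  vanishes.\<close>

lemma minimal_ratio:
  assumes "v \<in> balanced_maps P" "w \<in> balanced_maps P" "w \<noteq> 0"
  obtains S where "0 < w S" "\<And>S'. v S * w S' \<le> v S' * w S"
proof -
  have fin: "finite ((\<lambda>S. v S / w S) ` supp w)" using finite_supp[OF assms(2)] by simp
  have "supp w \<noteq> {}" using assms(3) supp_empty_iff by blast
  then have "Min ((\<lambda>S. v S / w S) ` supp w) \<in> (\<lambda>S. v S / w S) ` supp w"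
    using fin by (intro Min_in) auto
  then obtain S where S: "S \<in> supp w" "v S / w S = Min ((\<lambda>S. v S / w S) ` supp w)" by force
  then have pos: "0 < w S" using balanced_mapsD(1)[OF assms(2), of S] by (simp add: supp_def less_le)
  have "v S * w S' \<le> v S' * w S" for S'
  proof (cases "w S' = 0")
    case True then show ?thesis using balanced_mapsD(1)[OF assms(1), of S'] pos by simp
  next
    case False
    then have pos': "0 < w S'" using balanced_mapsD(1)[OF assms(2), of S'] by (simp add: less_le)
    have "v S / w S \<le> v S' / w S'" unfolding S(2) using fin False by (intro Min_le) (auto simp: supp_def)
    then show ?thesis using pos pos' by (simp add: divide_simps mult.commute)
  qed
  then show thesis using that pos by blast
qed

text \<open>\<open>t\<close> is the largest multiple of \<open>w\<close> that leaves a nonnegative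
  map; a cell of least ratio then drops out of the support.\<close>

lemma subtract_balanced:
  assumes v: "v \<in> balanced_maps P" and w: "w \<in> balanced_maps P" "w \<noteq> 0" and sub: "supp w \<subseteq> supp v"
  obtains t where "0 \<le> t" "v - t *\<^sub>R w \<in> balanced_maps P" "supp (v - t *\<^sub>R w) \<subset> supp v"
proof -
  obtain S where S: "0 < w S" "\<And>S'. v S * w S' \<le> v S' * w S" using minimal_ratio[OF v w] by blast
  define t where "t = v S / w S"
  have t: "t * w S' \<le> v S'" for S' using S by (simp add: t_def divide_simps)
  have eq: "v - t *\<^sub>R w = 1 *\<^sub>R v + (- t) *\<^sub>R w" by (simp add: fun_eq_iff)
  have "supp (v - t *\<^sub>R w) \<subseteq> supp v" using sub by (auto simp: supp_def)
  moreover have "S \<notin> supp (v - t *\<^sub>R w)" using S(1) by (simp add: supp_def t_def)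
  moreover have "S \<in> supp w" using S(1) by (simp add: supp_def)
  then have "S \<in> supp v" using sub by blast
  moreover have "v - t *\<^sub>R w \<in> balanced_maps P"
    unfolding eq using t by (intro balanced_maps_combine v w) simp
  moreover have "0 \<le> t" using S(1) balanced_mapsD(1)[OF v, of S] by (simp add: t_def)
  ultimately show thesis using that by blast
qed

lemma minimal_support_below:
  assumes "v \<in> balanced_maps P" "v \<noteq> 0"
  obtains w where "minimal_support w" "supp w \<subseteq> supp v"
proof -
  let ?Q = "\<lambda>w. w \<in> balanced_maps P \<and> w \<noteq> 0 \<and> supp w \<subseteq> supp v"
  obtain w where w: "?Q w" and min: "\<And>u. ?Q u \<Longrightarrow> card (supp w) \<le> card (supp u)"
    using ex_has_least_nat[of ?Q v "\<lambda>w. card (supp w)"] assms by blast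
  have "supp u = supp w" if u: "u \<in> balanced_maps P" "u \<noteq> 0" "supp u \<subseteq> supp w" for u
    using card_seteq[OF finite_supp u(3)] min[of u] u w by blast
  then have "minimal_support w" using w unfolding minimal_support_def by blast
  then show thesis using that w by blast
qed

text \<open>One integral representative is chosen for each minimal support; supports are sets of
  maximal cells, so there are finitely many.\<close>

lemma minimal_support_generators:
  obtains \<Omega> where "finite \<Omega>" "\<And>w. w \<in> \<Omega> \<Longrightarrow> minimal_support w" "\<And>w S. w \<in> \<Omega> \<Longrightarrow> w S \<in> \<int>"
    "inj_on supp \<Omega>" "\<And>w. minimal_support w \<Longrightarrow> \<exists>w'\<in>\<Omega>. supp w' = supp w"
proof -
  define \<S> where "\<S> = supp ` {w. minimal_support w}"
  have "\<S> \<subseteq> Pow (max_cells P)" using supp_subset by (auto simp: \<S>_def minimal_support_def)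
  then have fin: "finite \<S>" using finite_max_cells finite_subset by blast
  have "\<exists>w. minimal_support w \<and> supp w = s \<and> (\<forall>S. w S \<in> \<int>)" if s: "s \<in> \<S>" for s
  proof -
    obtain v where v: "minimal_support v" "supp v = s" using s by (auto simp: \<S>_def)
    then have "v \<in> balanced_maps P" by (simp add: minimal_support_def)
    then obtain w where w: "w \<in> balanced_maps P" "supp w = supp v" "\<forall>S. w S \<in> \<int>"
      using integer_balanced_map by blast
    then have "w \<noteq> 0" using v(1) supp_empty_iff by (metis minimal_support_def)
    then have "minimal_support w" using v(1) w unfolding minimal_support_def by metis
    then show ?thesis using w v(2) by blast
  qed
  then obtain f where f: "\<And>s. s \<in> \<S> \<Longrightarrow> minimal_support (f s)" "\<And>s. s \<in> \<S> \<Longrightarrow> supp (f s) = s"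
    "\<And>s S. s \<in> \<S> \<Longrightarrow> f s S \<in> \<int>" by metis
  show thesis
  proof (rule that[of "f ` \<S>"])
    show "inj_on supp (f ` \<S>)" using f(2) by (auto simp: inj_on_def)
    show "\<exists>w'\<in>f ` \<S>. supp w' = supp w" if "minimal_support w" for w
      using that f(2)[of "supp w"] by (auto simp: \<S>_def)
  qed (use fin f in auto)
qed

text \<open>Induction on the size of the support, subtracting a representative whose support lies
  below. If the support of \<open>v\<close> is itself minimal, the remainder has smaller support and
  is 0; this is how proportionality enters.\<close>

lemma generated_by_minimal_support:
  assumes fin: "finite \<Omega>" and \<Omega>: "\<And>w. w \<in> \<Omega> \<Longrightarrow> minimal_support w"
    and all: "\<And>w. minimal_support w \<Longrightarrow> \<exists>w'\<in>\<Omega>. supp w' = supp w"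
    and "v \<in> balanced_maps P"
  shows "\<exists>c. (\<forall>a\<in>\<Omega>. 0 \<le> c a) \<and> v = (\<Sum>a\<in>\<Omega>. c a *\<^sub>R a)"
  using assms(4)
proof (induction "card (supp v)" arbitrary: v rule: less_induct)
  case less
  note v = less.prems
  show ?case
  proof (cases "v = 0")
    case True
    then show ?thesis by (intro exI[of _ "\<lambda>_. 0"]) simp
  next
    case False
    obtain w0 where w0: "minimal_support w0" "supp w0 \<subseteq> supp v" using minimal_support_below[OF v False] .
    obtain w where w: "w \<in> \<Omega>" "supp w = supp w0" using all[OF w0(1)] by blast
    have wW: "w \<in> balanced_maps P" "w \<noteq> 0" using \<Omega>[OF w(1)] by (auto simp: minimal_support_def)
    obtain t where t: "0 \<le> t" "v - t *\<^sub>R w \<in> balanced_maps P" "supp (v - t *\<^sub>R w) \<subset> supp v"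
      using subtract_balanced[OF v wW] w(2) w0(2) by blast
    obtain c where c: "\<forall>a\<in>\<Omega>. 0 \<le> c a" "v - t *\<^sub>R w = (\<Sum>a\<in>\<Omega>. c a *\<^sub>R a)"
      using less.hyps[OF psubset_card_mono[OF finite_supp[OF v] t(3)] t(2)] by blast
    have "v = (\<Sum>a\<in>\<Omega>. c a *\<^sub>R a) + t *\<^sub>R w" using c(2) by (simp add: diff_eq_eq)
    also have "\<dots> = (\<Sum>a\<in>\<Omega>. c a *\<^sub>R a) + (\<Sum>a\<in>\<Omega>. if a = w then t *\<^sub>R a else 0)"
      using w(1) fin by simp
    also have "\<dots> = (\<Sum>a\<in>\<Omega>. (c a + (if a = w then t else 0)) *\<^sub>R a)"
      unfolding sum.distrib[symmetric] by (rule sum.cong) (auto simp: scaleR_add_left)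
    finally show ?thesis
      using c(1) t(1) by (intro exI[of _ "\<lambda>a. c a + (if a = w then t else 0)"]) auto
  qed
qed

text \<open>Nonnegative summands cannot cancel, so in any expression of \<open>w\<close> each
  nonzero summand has its support inside that of \<open>w\<close>, hence equal to it by minimality.
  Every generating set therefore has an element for each minimal support, and different supports
  need different elements.\<close>

lemma minimal_generating_set_minimal_support:
  assumes fin: "finite \<Omega>" and \<Omega>: "\<And>w. w \<in> \<Omega> \<Longrightarrow> minimal_support w"
    and inj: "inj_on supp \<Omega>"
    and all: "\<And>w. minimal_support w \<Longrightarrow> \<exists>w'\<in>\<Omega>. supp w' = supp w"
  shows "minimal_generating_set (balanced_maps P) \<Omega>"
  unfolding minimal_generating_set_def
proof (intro conjI allI impI fin)
  show "generating_set (balanced_maps P) \<Omega>"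
    unfolding generating_set_def
  proof (intro conjI ballI)
    show "\<Omega> \<subseteq> balanced_maps P" using \<Omega> by (auto simp: minimal_support_def)
    fix x assume "x \<in> balanced_maps P"
    then obtain c where "\<forall>a\<in>\<Omega>. 0 \<le> c a" "x = (\<Sum>a\<in>\<Omega>. c a *\<^sub>R a)"
      using generated_by_minimal_support[OF fin \<Omega> all] by metis
    then show "\<exists>F c. finite F \<and> F \<subseteq> \<Omega> \<and> (\<forall>a\<in>F. 0 \<le> c a) \<and> x = (\<Sum>a\<in>F. c a *\<^sub>R a)"
      using fin by (intro exI[of _ \<Omega>] exI[of _ c]) simp
  qed
  fix B assume "finite B \<and> generating_set (balanced_maps P) B"
  then have B: "finite B" "B \<subseteq> balanced_maps P" "\<And>x. x \<in> balanced_maps P \<Longrightarrow>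
      \<exists>F c. finite F \<and> F \<subseteq> B \<and> (\<forall>a\<in>F. 0 \<le> c a) \<and> x = (\<Sum>a\<in>F. c a *\<^sub>R a)"
    unfolding generating_set_def by blast+
  have "\<exists>b\<in>B. supp b = supp w" if w: "w \<in> \<Omega>" for w
  proof -
    have wW: "w \<in> balanced_maps P" "w \<noteq> 0" using \<Omega>[OF w] by (auto simp: minimal_support_def)
    obtain F c where F: "finite F" "F \<subseteq> B" "\<And>a. a \<in> F \<Longrightarrow> 0 \<le> c a" "w = (\<Sum>a\<in>F. c a *\<^sub>R a)"
      using B(3)[OF wW(1)] by blast
    have wS: "w S = (\<Sum>a\<in>F. c a * a S)" for S unfolding F(4) by (simp add: sum_fun_apply)
    have "supp w \<noteq> {}" using wW(2) supp_empty_iff by blast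
    then obtain S where "w S \<noteq> 0" by (auto simp: supp_def)
    then have "(\<Sum>a\<in>F. c a * a S) \<noteq> 0" using wS by simp
    then obtain a where a: "a \<in> F" "c a * a S \<noteq> 0" by (rule sum.not_neutral_contains_not_neutral)
    have aW: "a \<in> balanced_maps P" using a(1) F(2) B(2) by blast
    have "a \<noteq> 0" using a(2) by auto
    moreover have "supp a \<subseteq> supp w"
    proof
      fix S' assume "S' \<in> supp a"
      then have "0 < a S'" using balanced_mapsD(1)[OF aW, of S'] by (simp add: supp_def less_le)
      then have "0 < c a * a S'" using a F(3)[OF a(1)] by (simp add: less_le)
      also have "\<dots> \<le> w S'" unfolding wS
        using F balanced_mapsD(1) B(2) by (intro member_le_sum[OF a(1)]) (auto intro!: mult_nonneg_nonneg)
      finally show "S' \<in> supp w" by (simp add: supp_def)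
    qed
    ultimately have "supp a = supp w" using \<Omega>[OF w] aW unfolding minimal_support_def by blast
    then show ?thesis using a(1) F(2) by blast
  qed
  then obtain h where h: "\<And>w. w \<in> \<Omega> \<Longrightarrow> h w \<in> B" "\<And>w. w \<in> \<Omega> \<Longrightarrow> supp (h w) = supp w" by metis
  have "inj_on h \<Omega>"
  proof
    fix x y assume "x \<in> \<Omega>" "y \<in> \<Omega>" "h x = h y"
    then show "x = y" using h(2) inj_onD[OF inj] by metis
  qed
  then show "card \<Omega> \<le> card B" using h(1) B(1) by (intro card_inj_on_le) auto
qed

section \<open>Supports of integer balanced maps and subvarieties\<close>

lemma support_variety_subset_iff:
  assumes "v \<in> balanced_maps P" "w \<in> balanced_maps P"
  shows "support_variety P v \<subseteq> support_variety P w \<longleftrightarrow> supp v \<subseteq> supp w"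
proof
  assume sub: "support_variety P v \<subseteq> support_variety P w"
  show "supp v \<subseteq> supp w"
  proof
    fix S assume S: "S \<in> supp v"
    then have Sm: "S \<in> max_cells P" using supp_subset[OF assms(1)] by blast
    note SP = max_cell(1)[OF Sm]
    have pos: "0 < v S" using S balanced_mapsD(1)[OF assms(1), of S] by (simp add: supp_def less_le)
    \<comment> \<open>A relative interior point of a maximal cell lies in no other maximal cell, so
      the set determines which cells were used.\<close>
    obtain x where x: "x \<in> rel_interior S" using rel_interior_eq_empty[OF cell(2)[OF SP]] cell(4)[OF SP] by blast
    then have "x \<in> support_variety P v" using pos Sm rel_interior_subset unfolding support_variety_def by blast
    then obtain S' where S': "S' \<in> max_cells P" "0 < w S'" "x \<in> S'" using sub unfolding support_variety_def by blast
    have "S' = S" using rel_interior_max_cell_unique[OF Sm max_cell(1)[OF S'(1)] x S'(3)] .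
    then show "S \<in> supp w" using S'(2) by (simp add: supp_def)
  qed
next
  assume sub: "supp v \<subseteq> supp w"
  have "0 < w S" if "0 < v S" for S
    using that sub balanced_mapsD(1)[OF assms(2), of S] by (auto simp: supp_def less_le)
  then show "support_variety P v \<subseteq> support_variety P w" unfolding support_variety_def by blast
qed

lemma support_variety_eq_iff:
  assumes "v \<in> balanced_maps P" "w \<in> balanced_maps P"
  shows "support_variety P v = support_variety P w \<longleftrightarrow> supp v = supp w"
  using support_variety_subset_iff[OF assms] support_variety_subset_iff[OF assms(2,1)] by blast

lemma support_variety_subset: "support_variety P w \<subseteq> \<Union>P"
  unfolding support_variety_def using max_cell(1) by blast

text \<open>Take all nonempty faces of positively weighted cells. Ridges of this complex are ridges
  of \<open>P\<close>, and the cells missing at such a ridge have weight 0, so the balancing sums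
  are unchanged.\<close>

lemma tropical_support_variety:
  assumes w: "w \<in> balanced_maps P" "w \<noteq> 0" and int: "\<And>S. w S \<in> \<int>"
  shows "tropical_variety (complex_dim P) (support_variety P w)"
proof -
  define R where "R = {F. F \<noteq> {} \<and> (\<exists>S\<in>max_cells P. 0 < w S \<and> F face_of S)}"
  have RP: "R \<subseteq> P" using face_cell max_cell(1) unfolding R_def by blast
  have finR: "finite R" using RP finite_cells finite_subset by blast
  have inR: "S \<in> R" if "S \<in> max_cells P" "0 < w S" for S
    using that cell(2,4)[OF max_cell(1)[OF that(1)]] face_of_refl unfolding R_def by blast
  have "supp w \<noteq> {}" using w(2) supp_empty_iff by blast
  then obtain S0 where "w S0 \<noteq> 0" by (auto simp: supp_def)
  then have S0: "0 < w S0" "S0 \<in> max_cells P"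
    using balanced_mapsD(1,2)[OF w(1), of S0] by (auto simp: less_le)
  have dimR: "complex_dim R = complex_dim P"
    unfolding complex_dim_def[of R]
  proof (rule Max_eqI)
    show "finite (aff_dim ` R)" using finR by simp
    show "y \<le> complex_dim P" if "y \<in> aff_dim ` R" for y using that RP cell_dim_le by blast
    show "complex_dim P \<in> aff_dim ` R" using inR[OF S0(2,1)] max_cell(2)[OF S0(2)] by force
  qed
  have maxR: "max_cells R = {S \<in> max_cells P. 0 < w S}"
  proof (intro equalityI subsetI)
    fix F assume F: "F \<in> max_cells R"
    then have FR: "F \<in> R" "aff_dim F = complex_dim P" using dimR by (auto simp: max_cells_def)
    then obtain S where S: "S \<in> max_cells P" "0 < w S" "F face_of S" unfolding R_def by blast
    have "F = S"
      using face_of_aff_dim_lt[OF cell(2)[OF max_cell(1)[OF S(1)]] S(3)] FR(2) max_cell(2)[OF S(1)] by force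
    then show "F \<in> {S \<in> max_cells P. 0 < w S}" using S by blast
  next
    fix S assume "S \<in> {S \<in> max_cells P. 0 < w S}"
    then show "S \<in> max_cells R" using inR dimR max_cell(2) by (auto simp: max_cells_def[of R])
  qed
  have ridR: "ridges R \<subseteq> ridges P" using RP dimR by (auto simp: ridges_def)
  have "polyhedral_complex R"
    unfolding polyhedral_complex_def
  proof (intro conjI ballI allI impI finR)
    show "R \<noteq> {}" using inR[OF S0(2,1)] by blast
    fix S assume S: "S \<in> R"
    then have SP: "S \<in> P" using RP by blast
    show "polyhedron S" "S \<noteq> {}" using cell[OF SP] by auto
    show "F \<in> R" if "F face_of S \<and> F \<noteq> {}" for F
      using S that face_of_trans unfolding R_def by blast
    fix T assume "T \<in> R"
    then have TP: "T \<in> P" using RP by blast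
    show "S \<inter> T face_of S" "S \<inter> T face_of T" using Int_face[OF SP TP] by auto
  qed
  moreover have "pure_complex R"
    unfolding pure_complex_def maxR unfolding R_def by blast
  moreover have "rational_complex R"
    using rational ridR unfolding rational_complex_def maxR by blast
  moreover have "w \<in> balanced_maps R"
    unfolding balanced_maps_def
  proof (intro CollectI conjI ballI allI impI)
    show "0 \<le> w S" for S using balanced_mapsD(1)[OF w(1)] .
    show "w S = 0" if "S \<notin> max_cells R" for S
      using that balanced_mapsD(1,2)[OF w(1), of S] by (auto simp: maxR less_le)
    fix T assume T: "T \<in> ridges R"
    have "(\<Sum>S | S \<in> max_cells R \<and> T face_of S. w S *\<^sub>R ridge_normal T S) =
      (\<Sum>S | S \<in> max_cells P \<and> T face_of S. w S *\<^sub>R ridge_normal T S)"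
      using finite_max_cells balanced_mapsD(1)[OF w(1)]
      by (intro sum.mono_neutral_left) (auto simp: maxR less_le)
    then show "(\<Sum>S | S \<in> max_cells R \<and> T face_of S. w S *\<^sub>R ridge_normal T S) \<in> parallel_space T"
      using balanced_mapsD(3)[OF w(1)] ridR T by auto
  qed
  moreover have "weighting R w" using int by (auto simp: weighting_def maxR)
  moreover have "\<Union>R = support_variety P w"
  proof
    show "\<Union>R \<subseteq> support_variety P w"
      unfolding R_def support_variety_def using face_of_imp_subset by blast
    show "support_variety P w \<subseteq> \<Union>R" using inR unfolding support_variety_def by blast
  qed
  ultimately show ?thesis
    unfolding tropical_variety_def tropical_complex_def using dimR by blast
qed

lemma subvariety_support:
  assumes "tropical_variety (complex_dim P) X" "X \<subseteq> \<Union>P"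
  obtains w where "w \<in> balanced_maps P" "w \<noteq> 0" "\<And>S. w S \<in> \<int>" "support_variety P w = X"
proof -
  obtain Q u where Q: "polyhedral_complex Q" "pure_complex Q" "rational_complex Q" "complex_dim Q = complex_dim P" "X = \<Union>Q"
    and u: "u \<in> balanced_maps Q" "weighting Q u"
    using assms(1) unfolding tropical_variety_def tropical_complex_def by blast
  interpret tropical_subcomplex P Q u
    using Q u assms(2) by unfold_locales (auto simp: weighting_def)
  have int: "pushed S \<in> \<int>" for S
  proof (cases "pushed S = 0")
    case False
    then obtain q where "q \<in> max_cells Q" "pushed S = u q" using pushed_nonzero[of S] by metis
    then show ?thesis using u(2) by (simp add: weighting_def)
  qed simp
  have "pushed \<noteq> 0"
  proof
    assume "pushed = 0"
    then have "\<Union>Q = {}" using support_variety_pushed by (auto simp: support_variety_def)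
    then show False using Q.max_cells_nonempty cells(1,4) by blast
  qed
  then show thesis using that pushed_in_balanced_maps int support_variety_pushed Q(5) by metis
qed

section \<open>Dimensions of subvarieties and extremality\<close>

lemma tropical_variety_covers:
  assumes "tropical_variety k X"
  obtains \<Q> where "finite \<Q>" "X = \<Union>\<Q>" "\<And>q. q \<in> \<Q> \<Longrightarrow> aff_dim q \<le> k"
    "\<exists>q\<in>\<Q>. aff_dim q = k \<and> convex q \<and> q \<noteq> {}"
proof -
  obtain Q where Q: "pure_rational_complex Q" "complex_dim Q = k" "X = \<Union>Q"
    using assms unfolding tropical_variety_def tropical_complex_def pure_rational_complex_def by blast
  interpret Q: pure_rational_complex Q by (rule Q(1))
  obtain q where q: "q \<in> max_cells Q" using Q.max_cells_nonempty by blast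
  show thesis
  proof (rule that[of Q])
    show "\<exists>q\<in>Q. aff_dim q = k \<and> convex q \<and> q \<noteq> {}"
      using Q.max_cell[OF q] Q.cell[of q] Q(2) by blast
  qed (use Q Q.finite_cells Q.cell_dim_le in auto)
qed

lemma subvariety_dim_le:
  assumes "tropical_variety k X" "X \<subseteq> \<Union>P"
  shows "k \<le> complex_dim P"
proof -
  obtain \<Q> q where q: "X = \<Union>\<Q>" "q \<in> \<Q>" "aff_dim q = k" "convex q" "q \<noteq> {}"
    using tropical_variety_covers[OF assms(1)] by metis
  then have "q \<subseteq> \<Union>P" using assms(2) by blast
  then obtain S where S: "S \<in> P" "aff_dim (S \<inter> q) = aff_dim q"
    using convex_cover_full_dim[OF finite_cells q(4,5)] by blast
  then show ?thesis using aff_dim_subset[of "S \<inter> q" S] cell_dim_le[OF S(1)] q(3) by simp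
qed

text \<open>Decompositions may mix dimensions. One of the finitely many cells of both varieties must
  meet \<open>S\<close> in full dimension, so one piece is accessible to
  \<open>subvariety_support\<close>.\<close>

lemma union_of_subvarieties_dim:
  assumes "tropical_variety k1 X1" "tropical_variety k2 X2" "X1 \<union> X2 \<subseteq> \<Union>P"
    and S: "S \<in> max_cells P" "S \<subseteq> X1 \<union> X2"
  shows "k1 = complex_dim P \<or> k2 = complex_dim P"
proof -
  obtain \<Q>1 where Q1: "finite \<Q>1" "X1 = \<Union>\<Q>1" "\<And>q. q \<in> \<Q>1 \<Longrightarrow> aff_dim q \<le> k1"
    using tropical_variety_covers[OF assms(1)] by metis
  obtain \<Q>2 where Q2: "finite \<Q>2" "X2 = \<Union>\<Q>2" "\<And>q. q \<in> \<Q>2 \<Longrightarrow> aff_dim q \<le> k2"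
    using tropical_variety_covers[OF assms(2)] by metis
  have "S \<subseteq> \<Union>(\<Q>1 \<union> \<Q>2)" using S(2) Q1(2) Q2(2) by blast
  then obtain q where q: "q \<in> \<Q>1 \<union> \<Q>2" "aff_dim (q \<inter> S) = aff_dim S"
    using convex_cover_full_dim[of "\<Q>1 \<union> \<Q>2" S] Q1(1) Q2(1) cell(2,4)[OF max_cell(1)[OF S(1)]] by auto
  have "complex_dim P \<le> aff_dim q"
    using q(2) aff_dim_subset[of "q \<inter> S" q] max_cell(2)[OF S(1)] by simp
  then have "complex_dim P \<le> k1 \<or> complex_dim P \<le> k2" using q(1) Q1(3) Q2(3) by fastforce
  then show ?thesis
    using subvariety_dim_le[OF assms(1)] subvariety_dim_le[OF assms(2)] assms(3) by auto
qed

text \<open>A full-dimensional proper subvariety would come from a nonzero balanced map of strictly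
  smaller support.\<close>

lemma minimal_support_imp_extremal:
  assumes w: "minimal_support w" and int: "\<And>S. w S \<in> \<int>"
  shows "extremal_tropical_variety (support_variety P w)"
proof -
  have wW: "w \<in> balanced_maps P" "w \<noteq> 0" using w by (auto simp: minimal_support_def)
  have no: False if X: "tropical_variety (complex_dim P) X" "X \<subset> support_variety P w" for X
  proof -
    have "X \<subseteq> \<Union>P" using X(2) support_variety_subset by blast
    then obtain v where v: "v \<in> balanced_maps P" "v \<noteq> 0" "support_variety P v = X"
      using subvariety_support[OF X(1)] by metis
    then have "supp v \<subseteq> supp w" using support_variety_subset_iff[OF v(1) wW(1)] X(2) by blast
    then have "supp v = supp w" using w v unfolding minimal_support_def by blast
    then show False using support_variety_eq_iff[OF v(1) wW(1)] v(3) X(2) by blast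
  qed
  have "supp w \<noteq> {}" using wW(2) supp_empty_iff by blast
  then obtain S where S: "S \<in> supp w" by blast
  then have Sm: "S \<in> max_cells P" using supp_subset[OF wW(1)] by blast
  have "0 < w S" using S balanced_mapsD(1)[OF wW(1), of S] by (simp add: supp_def less_le)
  then have Ssub: "S \<subseteq> support_variety P w" using Sm unfolding support_variety_def by blast
  show ?thesis
    unfolding extremal_tropical_variety_def
  proof (intro conjI notI)
    show "\<exists>k. tropical_variety k (support_variety P w)"
      using tropical_support_variety[OF wW int] by blast
    assume "\<exists>X1 X2 k1 k2. tropical_variety k1 X1 \<and> tropical_variety k2 X2 \<and>
      X1 \<subset> support_variety P w \<and> X2 \<subset> support_variety P w \<and> support_variety P w = X1 \<union> X2"
    then obtain X1 X2 k1 k2 where X: "tropical_variety k1 X1" "tropical_variety k2 X2"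
      "X1 \<subset> support_variety P w" "X2 \<subset> support_variety P w" "support_variety P w = X1 \<union> X2" by blast
    have "k1 = complex_dim P \<or> k2 = complex_dim P"
      using X support_variety_subset Ssub by (intro union_of_subvarieties_dim[OF X(1,2) _ Sm]) auto
    then show False using no X by blast
  qed
qed

text \<open>Given a strictly smaller support, that of \<open>v\<close>, removing as much of
  \<open>v\<close> as possible from \<open>w\<close> leaves another map of smaller support. The two
  supports cover that of \<open>w\<close>, so their varieties decompose the given one.\<close>

lemma extremal_imp_minimal_support:
  assumes w: "w \<in> balanced_maps P" "w \<noteq> 0" and int: "\<And>S. w S \<in> \<int>"
    and ext: "extremal_tropical_variety (support_variety P w)"
  shows "minimal_support w"
proof -
  obtain v0 where v0: "minimal_support v0" "supp v0 \<subseteq> supp w" using minimal_support_below[OF w] .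
  have "v0 \<in> balanced_maps P" using v0(1) by (simp add: minimal_support_def)
  then obtain v where v: "v \<in> balanced_maps P" "supp v = supp v0" and intv: "\<forall>S. v S \<in> \<int>"
    using integer_balanced_map by blast
  have v_ne: "v \<noteq> 0" using v(2) v0(1) supp_empty_iff by (metis minimal_support_def)
  have sub: "supp v \<subseteq> supp w" using v(2) v0(2) by simp
  have "supp v = supp w"
  proof (rule ccontr)
    assume ne: "supp v \<noteq> supp w"
    obtain S where S: "0 < v S" "\<And>S'. w S * v S' \<le> w S' * v S" using minimal_ratio[OF w(1) v(1) v_ne] by blast
    \<comment> \<open>This is \<open>v S\<close> times the map left after subtracting from
      \<open>w\<close> the largest possible multiple of \<open>v\<close>; the scaling keeps the
      values integral.\<close>
    define w' where "w' = v S *\<^sub>R w + (- w S) *\<^sub>R v"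
    have w'W: "w' \<in> balanced_maps P" unfolding w'_def
      using S(2) by (intro balanced_maps_combine w v) (simp add: mult.commute)
    have w'S: "w' S' = v S * w S' - w S * v S'" for S' by (simp add: w'_def)
    have intw': "w' S' \<in> \<int>" for S' unfolding w'S using int intv by (intro Ints_diff Ints_mult) auto
    have sub': "supp w' \<subseteq> supp w" using sub by (auto simp: supp_def w'S)
    \<comment> \<open>Where \<open>w\<close> is nonzero but \<open>w'\<close> vanishes,
      \<open>w S * v S'\<close> equals \<open>v S * w S'\<close>, which is nonzero, so
      \<open>v\<close> is nonzero there.\<close>
    have un: "supp w = supp v \<union> supp w'"
      using sub sub' S(1) by (auto simp: supp_def w'S)
    have "S \<notin> supp w'" by (simp add: supp_def w'S)
    moreover have "S \<in> supp v" using S(1) by (simp add: supp_def)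
    then have "S \<in> supp w" using sub by blast
    ultimately have ne': "supp w' \<noteq> supp w" by blast
    have "w' \<noteq> 0" using un ne supp_empty_iff[of w'] by auto
    then have "tropical_variety (complex_dim P) (support_variety P w')"
      using tropical_support_variety[OF w'W _ intw'] by blast
    moreover have "tropical_variety (complex_dim P) (support_variety P v)"
      using tropical_support_variety[OF v(1) v_ne] intv by blast
    moreover have "support_variety P v \<subset> support_variety P w"
      using support_variety_subset_iff[OF v(1) w(1)] support_variety_eq_iff[OF v(1) w(1)] sub ne by blast
    moreover have "support_variety P w' \<subset> support_variety P w"
      using support_variety_subset_iff[OF w'W w(1)] support_variety_eq_iff[OF w'W w(1)] sub' ne' by blast
    moreover have "support_variety P w \<subseteq> support_variety P v \<union> support_variety P w'"
    proof
      fix y assume "y \<in> support_variety P w"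
      then obtain S' where S': "S' \<in> max_cells P" "0 < w S'" "y \<in> S'" unfolding support_variety_def by blast
      then have "S' \<in> supp w" by (simp add: supp_def)
      then have "S' \<in> supp v \<union> supp w'" using un by simp
      then have "v S' \<noteq> 0 \<or> w' S' \<noteq> 0" by (simp add: supp_def)
      then have "0 < v S' \<or> 0 < w' S'"
        using balanced_mapsD(1)[OF v(1), of S'] balanced_mapsD(1)[OF w'W, of S'] by linarith
      then show "y \<in> support_variety P v \<union> support_variety P w'"
        using S' unfolding support_variety_def by blast
    qed
    ultimately show False using ext unfolding extremal_tropical_variety_def by blast
  qed
  then show ?thesis using v0(1) v(2) w unfolding minimal_support_def by metis
qed

end

theorem theorem5p4:
  fixes P :: "(real^'d) set set"
  assumes "tropical_complex P"
    and "\<not> extremal_tropical_variety (\<Union>P)"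
  shows "finitely_generated_cone (balanced_maps P) \<and>
    strongly_convex_cone (balanced_maps P) \<and>
    (\<exists>\<Omega>. minimal_generating_set (balanced_maps P) \<Omega> \<and>
      (\<forall>\<omega>\<in>\<Omega>. \<omega> \<in> balanced_maps P \<and> strictly_partial_weighting P \<omega>) \<and>
      support_variety P ` \<Omega> =
        {X. tropical_variety (complex_dim P) X \<and> extremal_tropical_variety X \<and> X \<subseteq> \<Union>P})"
proof -
  interpret pure_rational_complex P
    using assms(1) by unfold_locales (auto simp: tropical_complex_def)
  obtain \<Omega> where fin: "finite \<Omega>" and min: "\<And>w. w \<in> \<Omega> \<Longrightarrow> minimal_support w"
    and int: "\<And>w S. w \<in> \<Omega> \<Longrightarrow> w S \<in> \<int>" and inj: "inj_on supp \<Omega>"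
    and all: "\<And>w. minimal_support w \<Longrightarrow> \<exists>w'\<in>\<Omega>. supp w' = supp w"
    using minimal_support_generators by metis
  have W: "w \<in> balanced_maps P" "w \<noteq> 0" if "w \<in> \<Omega>" for w
    using min[OF that] by (auto simp: minimal_support_def)
  have gen: "minimal_generating_set (balanced_maps P) \<Omega>"
    using minimal_generating_set_minimal_support[OF fin min inj all] .
  have "strictly_partial_weighting P w" if w: "w \<in> \<Omega>" for w
  proof -
    \<comment> \<open>Non-extremality enters here: a generator positive on every maximal cell has
      all of \<open>\<Union>P\<close> as its support variety, which would then be extremal.\<close>
    have "\<exists>S\<in>max_cells P. w S = 0"
    proof (rule ccontr)
      assume "\<not> ?thesis"
      then have "0 < w S" if "S \<in> max_cells P" for S
        using that balanced_mapsD(1)[OF W(1)[OF w], of S] by (auto simp: less_le)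
      then have "support_variety P w = \<Union>P" using Union_max_cells unfolding support_variety_def by blast
      then show False using minimal_support_imp_extremal[OF min[OF w] int[OF w]] assms(2) by simp
    qed
    then show ?thesis using int[OF w] balanced_mapsD(1)[OF W(1)[OF w]]
      unfolding strictly_partial_weighting_def partial_weighting_def by blast
  qed
  moreover have "support_variety P ` \<Omega> =
    {X. tropical_variety (complex_dim P) X \<and> extremal_tropical_variety X \<and> X \<subseteq> \<Union>P}"
  proof (intro equalityI subsetI)
    fix X assume "X \<in> support_variety P ` \<Omega>"
    then obtain w where w: "w \<in> \<Omega>" "X = support_variety P w" by blast
    then show "X \<in> {X. tropical_variety (complex_dim P) X \<and> extremal_tropical_variety X \<and> X \<subseteq> \<Union>P}"
      using tropical_support_variety[OF W[OF w(1)] int[OF w(1)]] support_variety_subset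
        minimal_support_imp_extremal[OF min[OF w(1)] int[OF w(1)]] by blast
  next
    fix X assume "X \<in> {X. tropical_variety (complex_dim P) X \<and> extremal_tropical_variety X \<and> X \<subseteq> \<Union>P}"
    then have X: "tropical_variety (complex_dim P) X" "extremal_tropical_variety X" "X \<subseteq> \<Union>P" by auto
    obtain v where v: "v \<in> balanced_maps P" "v \<noteq> 0" "\<And>S. v S \<in> \<int>" "support_variety P v = X"
      using subvariety_support[OF X(1,3)] by blast
    have "minimal_support v" using extremal_imp_minimal_support[OF v(1-3)] X(2) v(4) by simp
    then obtain w where w: "w \<in> \<Omega>" "supp w = supp v" using all by blast
    then have "support_variety P w = X" using support_variety_eq_iff[OF W(1)[OF w(1)] v(1)] v(4) by simp
    then show "X \<in> support_variety P ` \<Omega>" using w(1) by blast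
  qed
  moreover have "finitely_generated_cone (balanced_maps P)"
    using gen convex_cone_balanced_maps unfolding finitely_generated_cone_def minimal_generating_set_def by blast
  ultimately show ?thesis using gen W strongly_convex_cone_balanced_maps by blast
qed

end
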